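(* Internally to $\mathrm{cSet}$: given a fibrancy structure on $\mathbb{C}_1$ as a family over $\mathbb{C}_0\times\mathbb{C}_0$, naturally in the presheaf $\Gamma$ on $\mathbb{C}$, for every type $A$ over $\Gamma$ in the presheaf model on $\mathbb{C}$ there is a map from fibrancy structures on $UA$ over $U\Gamma$ in the model $\widehat{\mathbb{C}_0}$ of $\mathbb{C}_0$-indexed families to fibrancy structures on $UA$ regarded as a single family over the total type $\sum_{x:\mathbb{C}_0}\Gamma_x$.
   Context: Setting: $\mathrm{cSet}=\mathrm{PSh}(\Box)$ for a cubical model setup $(\Box,\mathbb{I},\Phi)$ satisfying the Orton–Pitts axioms, with $\mathbb{I}$ having connections and $\mathbb{I}\times(-)$ preserving representables; $\mathrm{cSet}$ is used as a model of extensional type theory. A fibrancy (composition) structure on a family $A$ over a type $\Gamma$ assigns to $e\in\{0,1\}$, $\varphi:\Phi$, $\gamma:\mathbb{I}\to\Gamma$ and a partial element $a:\prod_{i:\mathbb{I}}[i=e\vee\varphi]\to A\gamma_i$ a completion in $A\gamma_{1-e}$ agreeing with $a$ on $\varphi$. $\mathbb{C}$ is a strict category internal to $\mathrm{cSet}$ with type of objects $\mathbb{C}_0$ and morphism family $\mathbb{C}_1$. A presheaf $\Gamma$ on $\mathbb{C}$ has sets $\Gamma_x$ and restrictions; a type $A$ over $\Gamma$ has families $A(x,\gamma)$ with restrictions. $\widehat{\mathbb{C}_0}$ is the model of $\mathbb{C}_0$-indexed families with fibrancy taken componentwise: a fibrancy structure on $B$ over $\Delta$ is a family of fibrancy structures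 on $B_x$ over $\Delta_x$ for $x:\mathbb{C}_0$. $U$ is restriction from presheaves on $\mathbb{C}$ to $\mathbb{C}_0$-indexed families. *)

theory Defs
  imports "HOL-Library.FuncSet"
begin

(* The internal language of cSet = PSh(Box) is interpreted in the presheaf category with families:
   contexts are presheaves on Box, types over a context are presheaves on its category of
   elements, terms are sections.  The site is an arbitrary small category; restriction along
   f : Y \<rightarrow> X maps the fibre over X = tgt f to the fibre over Y = src f. *)

section \<open>Presheaves on a small category\<close>

record ('o, 'm) cat =
  Ob :: "'o set"
  Arr :: "'m set"
  src :: "'m \<Rightarrow> 'o"
  tgt :: "'m \<Rightarrow> 'o"
  idm :: "'o \<Rightarrow> 'm"
  cmp :: "'m \<Rightarrow> 'm \<Rightarrow> 'm"  (* cmp f g is "f after g" *)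

locale small_category =
  fixes S :: "('o, 'm, 'z) cat_scheme"
  assumes src_Ob: "f \<in> Arr S \<Longrightarrow> src S f \<in> Ob S"
    and tgt_Ob: "f \<in> Arr S \<Longrightarrow> tgt S f \<in> Ob S"
    and idm_Arr: "X \<in> Ob S \<Longrightarrow> idm S X \<in> Arr S"
    and src_idm: "X \<in> Ob S \<Longrightarrow> src S (idm S X) = X"
    and tgt_idm: "X \<in> Ob S \<Longrightarrow> tgt S (idm S X) = X"
    and cmp_Arr: "f \<in> Arr S \<Longrightarrow> g \<in> Arr S \<Longrightarrow> src S f = tgt S g \<Longrightarrow> cmp S f g \<in> Arr S"
    and src_cmp: "f \<in> Arr S \<Longrightarrow> g \<in> Arr S \<Longrightarrow> src S f = tgt S g \<Longrightarrow> src S (cmp S f g) = src S g"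
    and tgt_cmp: "f \<in> Arr S \<Longrightarrow> g \<in> Arr S \<Longrightarrow> src S f = tgt S g \<Longrightarrow> tgt S (cmp S f g) = tgt S f"
    and cmp_idm: "f \<in> Arr S \<Longrightarrow> cmp S f (idm S (src S f)) = f"
    and idm_cmp: "f \<in> Arr S \<Longrightarrow> cmp S (idm S (tgt S f)) f = f"
    and cmp_assoc: "f \<in> Arr S \<Longrightarrow> g \<in> Arr S \<Longrightarrow> h \<in> Arr S \<Longrightarrow>
      src S f = tgt S g \<Longrightarrow> src S g = tgt S h \<Longrightarrow> cmp S (cmp S f g) h = cmp S f (cmp S g h)"

definition into :: "('o, 'm, 'z) cat_scheme \<Rightarrow> 'o \<Rightarrow> 'm set" where
  "into S X = {f \<in> Arr S. tgt S f = X}"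

record ('o, 'm, 'x) psh =
  At :: "'o \<Rightarrow> 'x set"
  Rs :: "'m \<Rightarrow> 'x \<Rightarrow> 'x"

locale presheaf = small_category S
  for S :: "('o, 'm, 'z) cat_scheme" and P :: "('o, 'm, 'x) psh" +
  assumes Rs_At: "f \<in> Arr S \<Longrightarrow> x \<in> At P (tgt S f) \<Longrightarrow> Rs P f x \<in> At P (src S f)"
    and Rs_idm: "X \<in> Ob S \<Longrightarrow> x \<in> At P X \<Longrightarrow> Rs P (idm S X) x = x"
    and Rs_cmp: "f \<in> Arr S \<Longrightarrow> g \<in> Arr S \<Longrightarrow> src S f = tgt S g \<Longrightarrow> x \<in> At P (tgt S f) \<Longrightarrow>
      Rs P (cmp S f g) x = Rs P g (Rs P f x)"

definition psh_map ::
  "('o, 'm, 'z) cat_scheme \<Rightarrow> ('o, 'm, 'x) psh \<Rightarrow> ('o, 'm, 'y) psh \<Rightarrow> ('o \<Rightarrow> 'x \<Rightarrow> 'y) \<Rightarrow> bool" where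
  "psh_map S P Q t \<longleftrightarrow>
     (\<forall>X\<in>Ob S. \<forall>x\<in>At P X. t X x \<in> At Q X) \<and>
     (\<forall>f\<in>Arr S. \<forall>x\<in>At P (tgt S f). t (src S f) (Rs P f x) = Rs Q f (t (tgt S f) x))"

definition psh_isomorphic ::
  "('o, 'm, 'z) cat_scheme \<Rightarrow> ('o, 'm, 'x) psh \<Rightarrow> ('o, 'm, 'y) psh \<Rightarrow> bool" where
  "psh_isomorphic S P Q \<longleftrightarrow>
     (\<exists>t. psh_map S P Q t \<and> (\<forall>X\<in>Ob S. bij_betw (t X) (At P X) (At Q X)))"

definition psh_prod :: "('o, 'm, 'x) psh \<Rightarrow> ('o, 'm, 'y) psh \<Rightarrow> ('o, 'm, 'x \<times> 'y) psh" where
  "psh_prod P Q = \<lparr>At = (\<lambda>X. At P X \<times> At Q X), Rs = (\<lambda>f (x, y). (Rs P f x, Rs Q f y))\<rparr>"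

definition yoneda :: "('o, 'm, 'z) cat_scheme \<Rightarrow> 'o \<Rightarrow> ('o, 'm, 'm) psh" where
  "yoneda S X = \<lparr>At = (\<lambda>Y. {f \<in> Arr S. src S f = Y \<and> tgt S f = X}), Rs = (\<lambda>g f. cmp S f g)\<rparr>"

definition representable :: "('o, 'm, 'z) cat_scheme \<Rightarrow> ('o, 'm, 'x) psh \<Rightarrow> bool" where
  "representable S P \<longleftrightarrow> (\<exists>Z\<in>Ob S. psh_isomorphic S (yoneda S Z) P)"

definition sieves :: "('o, 'm, 'z) cat_scheme \<Rightarrow> 'o \<Rightarrow> 'm set set" where
  "sieves S X = {\<phi>. \<phi> \<subseteq> into S X \<and> (\<forall>f\<in>\<phi>. \<forall>g\<in>into S (src S f). cmp S f g \<in> \<phi>)}"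

definition sieve_pull :: "('o, 'm, 'z) cat_scheme \<Rightarrow> 'm \<Rightarrow> 'm set \<Rightarrow> 'm set" where
  "sieve_pull S f \<phi> = {g \<in> into S (src S f). cmp S f g \<in> \<phi>}"


section \<open>Types in context\<close>

(* Tr A f \<xi> : Fam A (tgt f) \<xi> \<rightarrow> Fam A (src f) (\<xi> restricted along f) *)
record ('o, 'm, 'x, 'a) ty =
  Fam :: "'o \<Rightarrow> 'x \<Rightarrow> 'a set"
  Tr :: "'m \<Rightarrow> 'x \<Rightarrow> 'a \<Rightarrow> 'a"

locale type_over = presheaf S \<Xi>
  for S :: "('o, 'm, 'z) cat_scheme" and \<Xi> :: "('o, 'm, 'x) psh" and A :: "('o, 'm, 'x, 'a) ty" +
  assumes Tr_Fam: "f \<in> Arr S \<Longrightarrow> \<xi> \<in> At \<Xi> (tgt S f) \<Longrightarrow> a \<in> Fam A (tgt S f) \<xi> \<Longrightarrow>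
      Tr A f \<xi> a \<in> Fam A (src S f) (Rs \<Xi> f \<xi>)"
    and Tr_idm: "X \<in> Ob S \<Longrightarrow> \<xi> \<in> At \<Xi> X \<Longrightarrow> a \<in> Fam A X \<xi> \<Longrightarrow> Tr A (idm S X) \<xi> a = a"
    and Tr_cmp: "f \<in> Arr S \<Longrightarrow> g \<in> Arr S \<Longrightarrow> src S f = tgt S g \<Longrightarrow>
      \<xi> \<in> At \<Xi> (tgt S f) \<Longrightarrow> a \<in> Fam A (tgt S f) \<xi> \<Longrightarrow>
      Tr A (cmp S f g) \<xi> a = Tr A g (Rs \<Xi> f \<xi>) (Tr A f \<xi> a)"

definition ext :: "('o, 'm, 'x) psh \<Rightarrow> ('o, 'm, 'x, 'a) ty \<Rightarrow> ('o, 'm, 'x \<times> 'a) psh" where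
  "ext \<Xi> A = \<lparr>At = (\<lambda>X. Sigma (At \<Xi> X) (Fam A X)), Rs = (\<lambda>f (\<xi>, a). (Rs \<Xi> f \<xi>, Tr A f \<xi> a))\<rparr>"

definition const_ty :: "('o, 'm, 'b) psh \<Rightarrow> ('o, 'm, 'x, 'b) ty" where
  "const_ty P = \<lparr>Fam = (\<lambda>X _. At P X), Tr = (\<lambda>f _. Rs P f)\<rparr>"

definition subst_ty ::
  "('o, 'm, 'z) cat_scheme \<Rightarrow> ('o \<Rightarrow> 'y \<Rightarrow> 'x) \<Rightarrow> ('o, 'm, 'x, 'a) ty \<Rightarrow> ('o, 'm, 'y, 'a) ty" where
  "subst_ty S t A = \<lparr>Fam = (\<lambda>X \<xi>. Fam A X (t X \<xi>)), Tr = (\<lambda>f \<xi>. Tr A f (t (tgt S f) \<xi>))\<rparr>"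

definition Sigma_ty ::
  "('o, 'm, 'x, 'b) ty \<Rightarrow> ('o, 'm, 'x \<times> 'b, 'a) ty \<Rightarrow> ('o, 'm, 'x, 'b \<times> 'a) ty" where
  "Sigma_ty B A = \<lparr>Fam = (\<lambda>X \<xi>. SIGMA b:Fam B X \<xi>. Fam A X (\<xi>, b)),
                   Tr = (\<lambda>f \<xi> (b, a). (Tr B f \<xi> b, Tr A f (\<xi>, b) a))\<rparr>"

(* Equality of types; the records may differ outside the relevant fibres. *)
definition ty_eq ::
  "('o, 'm, 'z) cat_scheme \<Rightarrow> ('o, 'm, 'x) psh \<Rightarrow> ('o, 'm, 'x, 'a) ty \<Rightarrow> ('o, 'm, 'x, 'a) ty \<Rightarrow> bool"
  where
  "ty_eq S \<Xi> A B \<longleftrightarrow> (\<forall>X\<in>Ob S. \<forall>\<xi>\<in>At \<Xi> X. Fam A X \<xi> = Fam B X \<xi> \<and>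
     (\<forall>f\<in>into S X. \<forall>a\<in>Fam A X \<xi>. Tr A f \<xi> a = Tr B f \<xi> a))"

definition ty_iso ::
  "('o, 'm, 'z) cat_scheme \<Rightarrow> ('o, 'm, 'x) psh \<Rightarrow> ('o, 'm, 'x, 'a) ty \<Rightarrow> ('o, 'm, 'x, 'b) ty \<Rightarrow>
   ('o \<Rightarrow> 'x \<Rightarrow> 'a \<Rightarrow> 'b) \<Rightarrow> bool" where
  "ty_iso S \<Xi> A B s \<longleftrightarrow>
     (\<forall>X\<in>Ob S. \<forall>\<xi>\<in>At \<Xi> X. bij_betw (s X \<xi>) (Fam A X \<xi>) (Fam B X \<xi>)) \<and>
     (\<forall>f\<in>Arr S. \<forall>\<xi>\<in>At \<Xi> (tgt S f). \<forall>a\<in>Fam A (tgt S f) \<xi>.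
        s (src S f) (Rs \<Xi> f \<xi>) (Tr A f \<xi> a) = Tr B f \<xi> (s (tgt S f) \<xi> a))"


section \<open>Cubical models\<close>

(* Cof X is the set of cofibrant propositions at stage X: Cof is a subobject of the object of
   sieves, i.e. of the subobject classifier.  Meet and Join are the connections. *)
record ('o, 'm, 'i) cube_base = "('o, 'm) cat" +
  Itv :: "('o, 'm, 'i) psh"
  Zero :: "'o \<Rightarrow> 'i"
  One :: "'o \<Rightarrow> 'i"
  Meet :: "'o \<Rightarrow> 'i \<Rightarrow> 'i \<Rightarrow> 'i"
  Join :: "'o \<Rightarrow> 'i \<Rightarrow> 'i \<Rightarrow> 'i"
  Cof :: "'o \<Rightarrow> 'm set set"

(* False is 0, True is 1, so 1 - e is \<not> e. *)
definition endpt :: "('o, 'm, 'i, 'z) cube_base_scheme \<Rightarrow> bool \<Rightarrow> 'o \<Rightarrow> 'i" where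
  "endpt S e X = (if e then One S X else Zero S X)"

(* The elements of the product of the representable on X with the interval. *)
definition cyl :: "('o, 'm, 'i, 'z) cube_base_scheme \<Rightarrow> 'o \<Rightarrow> ('m \<times> 'i) set" where
  "cyl S X = (SIGMA f:into S X. At (Itv S) (src S f))"

(* Predicates on the interval at stage X, i.e. subpresheaves of that product. *)
definition itv_preds :: "('o, 'm, 'i, 'z) cube_base_scheme \<Rightarrow> 'o \<Rightarrow> ('m \<times> 'i) set set" where
  "itv_preds S X = {P. P \<subseteq> cyl S X \<and>
     (\<forall>(f, i)\<in>P. \<forall>g\<in>into S (src S f). (cmp S f g, Rs (Itv S) g i) \<in> P)}"

definition sub_psh :: "('o, 'm, 'z) cat_scheme \<Rightarrow> ('o, 'm, 'x) psh \<Rightarrow> ('o \<Rightarrow> 'x \<Rightarrow> 'm set) \<Rightarrow> ('o, 'm, 'x) psh"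
  where
  "sub_psh S \<Xi> \<phi> = \<lparr>At = (\<lambda>X. {\<xi> \<in> At \<Xi> X. idm S X \<in> \<phi> X \<xi>}), Rs = Rs \<Xi>\<rparr>"

(* The strictness axiom: for a cofibrant proposition \<phi>, a type A defined on \<phi>, a total type B and
   an isomorphism s : A \<cong> B on \<phi>, there are a total type B' extending A and an isomorphism
   B' \<cong> B extending s.  The universe consists of the types with elements drawn from 'a, and the
   axiom is read in contexts with elements drawn from 'x. *)
definition strictness :: "('o, 'm, 'i, 'z) cube_base_scheme \<Rightarrow> 'x itself \<Rightarrow> 'a itself \<Rightarrow> bool" where
  "strictness S _ _ \<longleftrightarrow>
    (\<forall>(\<Xi> :: ('o, 'm, 'x) psh) \<phi> (A :: ('o, 'm, 'x, 'a) ty) (B :: ('o, 'm, 'x, 'a) ty) s.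
       presheaf S \<Xi> \<longrightarrow>
       (\<forall>X\<in>Ob S. \<forall>\<xi>\<in>At \<Xi> X. \<phi> X \<xi> \<in> Cof S X) \<longrightarrow>
       (\<forall>f\<in>Arr S. \<forall>\<xi>\<in>At \<Xi> (tgt S f). \<phi> (src S f) (Rs \<Xi> f \<xi>) = sieve_pull S f (\<phi> (tgt S f) \<xi>)) \<longrightarrow>
       type_over S (sub_psh S \<Xi> \<phi>) A \<longrightarrow> type_over S \<Xi> B \<longrightarrow> ty_iso S (sub_psh S \<Xi> \<phi>) A B s \<longrightarrow>
       (\<exists>B' s'. type_over S \<Xi> B' \<and> ty_iso S \<Xi> B' B s' \<and> ty_eq S (sub_psh S \<Xi> \<phi>) A B' \<and>
          (\<forall>X\<in>Ob S. \<forall>\<xi>\<in>At (sub_psh S \<Xi> \<phi>) X. \<forall>a\<in>Fam A X \<xi>. s' X \<xi> a = s X \<xi> a)))"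

(* The Orton-Pitts axioms in Kripke-Joyal form (at every stage X), for an interval with
   connections whose product with representables is representable. *)
locale cubical_model = small_category S
  for S :: "('o, 'm, 'i, 'z) cube_base_scheme" and tx :: "'x itself" and ta :: "'a itself" +
  assumes Itv: "presheaf S (Itv S)"
    and endpt_At: "X \<in> Ob S \<Longrightarrow> endpt S e X \<in> At (Itv S) X"
    and endpt_Rs: "f \<in> Arr S \<Longrightarrow> Rs (Itv S) f (endpt S e (tgt S f)) = endpt S e (src S f)"
    and Meet_At: "X \<in> Ob S \<Longrightarrow> i \<in> At (Itv S) X \<Longrightarrow> j \<in> At (Itv S) X \<Longrightarrow> Meet S X i j \<in> At (Itv S) X"
    and Meet_Rs: "f \<in> Arr S \<Longrightarrow> i \<in> At (Itv S) (tgt S f) \<Longrightarrow> j \<in> At (Itv S) (tgt S f) \<Longrightarrow>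
      Rs (Itv S) f (Meet S (tgt S f) i j) = Meet S (src S f) (Rs (Itv S) f i) (Rs (Itv S) f j)"
    and Join_At: "X \<in> Ob S \<Longrightarrow> i \<in> At (Itv S) X \<Longrightarrow> j \<in> At (Itv S) X \<Longrightarrow> Join S X i j \<in> At (Itv S) X"
    and Join_Rs: "f \<in> Arr S \<Longrightarrow> i \<in> At (Itv S) (tgt S f) \<Longrightarrow> j \<in> At (Itv S) (tgt S f) \<Longrightarrow>
      Rs (Itv S) f (Join S (tgt S f) i j) = Join S (src S f) (Rs (Itv S) f i) (Rs (Itv S) f j)"
    and Cof_sieve: "X \<in> Ob S \<Longrightarrow> Cof S X \<subseteq> sieves S X"
    and Cof_pull: "f \<in> Arr S \<Longrightarrow> \<phi> \<in> Cof S (tgt S f) \<Longrightarrow> sieve_pull S f \<phi> \<in> Cof S (src S f)"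
    and connected: "X \<in> Ob S \<Longrightarrow> P \<in> itv_preds S X \<Longrightarrow>
      (\<And>f i. (f, i) \<in> cyl S X \<Longrightarrow>
         (f, i) \<in> P \<or> (\<forall>g\<in>into S (src S f). (cmp S f g, Rs (Itv S) g i) \<notin> P)) \<Longrightarrow>
      P = cyl S X \<or> P = {}"
    and endpt_distinct: "X \<in> Ob S \<Longrightarrow> Zero S X \<noteq> One S X"
    and Meet_Zero: "X \<in> Ob S \<Longrightarrow> i \<in> At (Itv S) X \<Longrightarrow>
      Meet S X (Zero S X) i = Zero S X \<and> Meet S X i (Zero S X) = Zero S X"
    and Meet_One: "X \<in> Ob S \<Longrightarrow> i \<in> At (Itv S) X \<Longrightarrow>
      Meet S X (One S X) i = i \<and> Meet S X i (One S X) = i"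
    and Join_Zero: "X \<in> Ob S \<Longrightarrow> i \<in> At (Itv S) X \<Longrightarrow>
      Join S X (Zero S X) i = i \<and> Join S X i (Zero S X) = i"
    and Join_One: "X \<in> Ob S \<Longrightarrow> i \<in> At (Itv S) X \<Longrightarrow>
      Join S X (One S X) i = One S X \<and> Join S X i (One S X) = One S X"
    and Cof_endpt: "X \<in> Ob S \<Longrightarrow> i \<in> At (Itv S) X \<Longrightarrow>
      {f \<in> into S X. Rs (Itv S) f i = endpt S e (src S f)} \<in> Cof S X"
    and Cof_disj: "X \<in> Ob S \<Longrightarrow> \<phi> \<in> Cof S X \<Longrightarrow> \<psi> \<in> Cof S X \<Longrightarrow> \<phi> \<union> \<psi> \<in> Cof S X"
    and Cof_conj: "X \<in> Ob S \<Longrightarrow> \<phi> \<in> Cof S X \<Longrightarrow> \<psi> \<in> sieves S X \<Longrightarrow>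
      (\<And>f. f \<in> \<phi> \<Longrightarrow> sieve_pull S f \<psi> \<in> Cof S (src S f)) \<Longrightarrow> \<phi> \<inter> \<psi> \<in> Cof S X"
    and Cof_all: "X \<in> Ob S \<Longrightarrow> P \<in> itv_preds S X \<Longrightarrow>
      (\<And>f i. (f, i) \<in> cyl S X \<Longrightarrow>
         {g \<in> into S (src S f). (cmp S f g, Rs (Itv S) g i) \<in> P} \<in> Cof S (src S f)) \<Longrightarrow>
      {f \<in> into S X. \<forall>(g, i)\<in>cyl S (src S f). (cmp S f g, i) \<in> P} \<in> Cof S X"
    and strictness: "strictness S tx ta"
    and Itv_representable: "X \<in> Ob S \<Longrightarrow> representable S (psh_prod (Itv S) (yoneda S X))"


section \<open>Fibrancy structures\<close>

(* Below, \<Gamma> is a type over the context \<Xi> and A is a type over \<Xi>.\<Gamma>.  The elements at stage X over \<xi>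
   of dependent products out of the interval are natural families indexed by cyl X. *)

definition paths ::
  "('o, 'm, 'i, 'z) cube_base_scheme \<Rightarrow> ('o, 'm, 'x) psh \<Rightarrow> ('o, 'm, 'x, 'g) ty \<Rightarrow> 'o \<Rightarrow> 'x \<Rightarrow>
   ('m \<times> 'i \<Rightarrow> 'g) set" where
  "paths S \<Xi> \<Gamma> X \<xi> = {p \<in> (\<Pi>\<^sub>E (f, i)\<in>cyl S X. Fam \<Gamma> (src S f) (Rs \<Xi> f \<xi>)).
     \<forall>(f, i)\<in>cyl S X. \<forall>g\<in>into S (src S f).
       p (cmp S f g, Rs (Itv S) g i) = Tr \<Gamma> g (Rs \<Xi> f \<xi>) (p (f, i))}"

(* The part of cyl X on which i = e \<or> \<phi> holds. *)
definition tube ::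
  "('o, 'm, 'i, 'z) cube_base_scheme \<Rightarrow> 'o \<Rightarrow> bool \<Rightarrow> 'm set \<Rightarrow> ('m \<times> 'i) set" where
  "tube S X e \<phi> = {(f, i) \<in> cyl S X. i = endpt S e (src S f) \<or> f \<in> \<phi>}"

definition partials ::
  "('o, 'm, 'i, 'z) cube_base_scheme \<Rightarrow> ('o, 'm, 'x) psh \<Rightarrow> ('o, 'm, 'x \<times> 'g, 'a) ty \<Rightarrow>
   'o \<Rightarrow> 'x \<Rightarrow> bool \<Rightarrow> 'm set \<Rightarrow> ('m \<times> 'i \<Rightarrow> 'g) \<Rightarrow> ('m \<times> 'i \<Rightarrow> 'a) set" where
  "partials S \<Xi> A X \<xi> e \<phi> p =
     {a \<in> (\<Pi>\<^sub>E (f, i)\<in>tube S X e \<phi>. Fam A (src S f) (Rs \<Xi> f \<xi>, p (f, i))).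
        \<forall>(f, i)\<in>tube S X e \<phi>. \<forall>g\<in>into S (src S f).
          a (cmp S f g, Rs (Itv S) g i) = Tr A g (Rs \<Xi> f \<xi>, p (f, i)) (a (f, i))}"

definition path_pull ::
  "('o, 'm, 'i, 'z) cube_base_scheme \<Rightarrow> 'm \<Rightarrow> ('m \<times> 'i \<Rightarrow> 'g) \<Rightarrow> 'm \<times> 'i \<Rightarrow> 'g" where
  "path_pull S f p = restrict (\<lambda>(g, i). p (cmp S f g, i)) (cyl S (src S f))"

definition partial_pull ::
  "('o, 'm, 'i, 'z) cube_base_scheme \<Rightarrow> 'm \<Rightarrow> bool \<Rightarrow> 'm set \<Rightarrow> ('m \<times> 'i \<Rightarrow> 'a) \<Rightarrow> 'm \<times> 'i \<Rightarrow> 'a" where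
  "partial_pull S f e \<phi> a =
     restrict (\<lambda>(g, i). a (cmp S f g, i)) (tube S (src S f) e (sieve_pull S f \<phi>))"

definition fib_dom ::
  "('o, 'm, 'i, 'z) cube_base_scheme \<Rightarrow> ('o, 'm, 'x) psh \<Rightarrow> ('o, 'm, 'x, 'g) ty \<Rightarrow>
   ('o, 'm, 'x \<times> 'g, 'a) ty \<Rightarrow>
   ('o \<times> 'x \<times> bool \<times> 'm set \<times> ('m \<times> 'i \<Rightarrow> 'g) \<times> ('m \<times> 'i \<Rightarrow> 'a)) set" where
  "fib_dom S \<Xi> \<Gamma> A = {(X, \<xi>, e, \<phi>, p, a). X \<in> Ob S \<and> \<xi> \<in> At \<Xi> X \<and> \<phi> \<in> Cof S X \<and>
     p \<in> paths S \<Xi> \<Gamma> X \<xi> \<and> a \<in> partials S \<Xi> A X \<xi> e \<phi> p}"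

(* In context \<Xi>, fibrancy structures on A as a family over \<Gamma>: the sections over \<Xi> of the dependent
   product over e, \<phi>, p and a of the type of elements of A at the endpoint 1 - e of p that agree
   with a on \<phi>.  Paths in \<Gamma> lie over a fixed element of \<Xi>. *)
definition fib ::
  "('o, 'm, 'i, 'z) cube_base_scheme \<Rightarrow> ('o, 'm, 'x) psh \<Rightarrow> ('o, 'm, 'x, 'g) ty \<Rightarrow>
   ('o, 'm, 'x \<times> 'g, 'a) ty \<Rightarrow>
   ('o \<times> 'x \<times> bool \<times> 'm set \<times> ('m \<times> 'i \<Rightarrow> 'g) \<times> ('m \<times> 'i \<Rightarrow> 'a) \<Rightarrow> 'a) set" where
  "fib S \<Xi> \<Gamma> A =
     {c \<in> (\<Pi>\<^sub>E (X, \<xi>, e, \<phi>, p, a)\<in>fib_dom S \<Xi> \<Gamma> A. Fam A X (\<xi>, p (idm S X, endpt S (\<not> e) X))).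
        \<forall>(X, \<xi>, e, \<phi>, p, a)\<in>fib_dom S \<Xi> \<Gamma> A.
          (\<forall>f\<in>\<phi>. Tr A f (\<xi>, p (idm S X, endpt S (\<not> e) X)) (c (X, \<xi>, e, \<phi>, p, a)) =
                 a (f, endpt S (\<not> e) (src S f))) \<and>
          (\<forall>f\<in>into S X. Tr A f (\<xi>, p (idm S X, endpt S (\<not> e) X)) (c (X, \<xi>, e, \<phi>, p, a)) =
                 c (src S f, Rs \<Xi> f \<xi>, e, sieve_pull S f \<phi>, path_pull S f p, partial_pull S f e \<phi> a))}"

(* Reindexing along a context map t : \<Xi>' \<rightarrow> \<Xi> and a map s : \<Gamma>' \<rightarrow> \<Gamma>[t] of types over \<Xi>', where A' is
   the reindexing of A: its fibres are fibres of A, so the partial elements are unchanged. *)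
definition fib_reindex ::
  "('o, 'm, 'i, 'z) cube_base_scheme \<Rightarrow> ('o \<Rightarrow> 'y \<Rightarrow> 'x) \<Rightarrow> ('o \<Rightarrow> 'y \<Rightarrow> 'd \<Rightarrow> 'g) \<Rightarrow>
   ('o, 'm, 'y) psh \<Rightarrow> ('o, 'm, 'y, 'd) ty \<Rightarrow> ('o, 'm, 'y \<times> 'd, 'a) ty \<Rightarrow>
   ('o \<times> 'x \<times> bool \<times> 'm set \<times> ('m \<times> 'i \<Rightarrow> 'g) \<times> ('m \<times> 'i \<Rightarrow> 'a) \<Rightarrow> 'a) \<Rightarrow>
   ('o \<times> 'y \<times> bool \<times> 'm set \<times> ('m \<times> 'i \<Rightarrow> 'd) \<times> ('m \<times> 'i \<Rightarrow> 'a) \<Rightarrow> 'a)" where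
  "fib_reindex S t s \<Xi>' \<Gamma>' A' c =
     restrict (\<lambda>(X, \<xi>, e, \<phi>, p, a).
         c (X, t X \<xi>, e, \<phi>,
            restrict (\<lambda>(f, i). s (src S f) (Rs \<Xi>' f \<xi>) (p (f, i))) (cyl S X), a))
       (fib_dom S \<Xi>' \<Gamma>' A')"


section \<open>Internal categories and presheaves on them\<close>

record ('o, 'm, 'c, 'h) icat =
  C0 :: "('o, 'm, 'c) psh"
  C1 :: "('o, 'm, 'c \<times> 'c, 'h) ty"
  cid :: "'o \<Rightarrow> 'c \<Rightarrow> 'h"
  ccmp :: "'o \<Rightarrow> 'c \<Rightarrow> 'c \<Rightarrow> 'c \<Rightarrow> 'h \<Rightarrow> 'h \<Rightarrow> 'h"
    (* ccmp X x y z k h is "k after h" for h : x \<rightarrow> y and k : y \<rightarrow> z at stage X *)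

locale internal_category = small_category S
  for S :: "('o, 'm, 'z) cat_scheme" and CC :: "('o, 'm, 'c, 'h) icat" +
  assumes C0: "presheaf S (C0 CC)"
    and C1: "type_over S (psh_prod (C0 CC) (C0 CC)) (C1 CC)"
    and cid_Fam: "X \<in> Ob S \<Longrightarrow> x \<in> At (C0 CC) X \<Longrightarrow> cid CC X x \<in> Fam (C1 CC) X (x, x)"
    and cid_Tr: "f \<in> Arr S \<Longrightarrow> x \<in> At (C0 CC) (tgt S f) \<Longrightarrow>
      Tr (C1 CC) f (x, x) (cid CC (tgt S f) x) = cid CC (src S f) (Rs (C0 CC) f x)"
    and ccmp_Fam: "X \<in> Ob S \<Longrightarrow>
      x \<in> At (C0 CC) X \<Longrightarrow> y \<in> At (C0 CC) X \<Longrightarrow> z \<in> At (C0 CC) X \<Longrightarrow>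
      h \<in> Fam (C1 CC) X (x, y) \<Longrightarrow> k \<in> Fam (C1 CC) X (y, z) \<Longrightarrow>
      ccmp CC X x y z k h \<in> Fam (C1 CC) X (x, z)"
    and ccmp_Tr: "f \<in> Arr S \<Longrightarrow>
      x \<in> At (C0 CC) (tgt S f) \<Longrightarrow> y \<in> At (C0 CC) (tgt S f) \<Longrightarrow> z \<in> At (C0 CC) (tgt S f) \<Longrightarrow>
      h \<in> Fam (C1 CC) (tgt S f) (x, y) \<Longrightarrow> k \<in> Fam (C1 CC) (tgt S f) (y, z) \<Longrightarrow>
      Tr (C1 CC) f (x, z) (ccmp CC (tgt S f) x y z k h) =
      ccmp CC (src S f) (Rs (C0 CC) f x) (Rs (C0 CC) f y) (Rs (C0 CC) f z)
        (Tr (C1 CC) f (y, z) k) (Tr (C1 CC) f (x, y) h)"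
    and ccmp_cid: "X \<in> Ob S \<Longrightarrow> x \<in> At (C0 CC) X \<Longrightarrow> y \<in> At (C0 CC) X \<Longrightarrow>
      h \<in> Fam (C1 CC) X (x, y) \<Longrightarrow>
      ccmp CC X x x y h (cid CC X x) = h \<and> ccmp CC X x y y (cid CC X y) h = h"
    and ccmp_assoc: "X \<in> Ob S \<Longrightarrow> w \<in> At (C0 CC) X \<Longrightarrow>
      x \<in> At (C0 CC) X \<Longrightarrow> y \<in> At (C0 CC) X \<Longrightarrow> z \<in> At (C0 CC) X \<Longrightarrow>
      h \<in> Fam (C1 CC) X (w, x) \<Longrightarrow> k \<in> Fam (C1 CC) X (x, y) \<Longrightarrow> l \<in> Fam (C1 CC) X (y, z) \<Longrightarrow>
      ccmp CC X w x z (ccmp CC X x y z l k) h = ccmp CC X w y z l (ccmp CC X w x y k h)"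

(* The context \<Xi> extended by x : C0. *)
abbreviation ctx_ob :: "('o, 'm, 'c, 'h) icat \<Rightarrow> ('o, 'm, 'x) psh \<Rightarrow> ('o, 'm, 'x \<times> 'c) psh" where
  "ctx_ob CC \<Xi> \<equiv> ext \<Xi> (const_ty (C0 CC))"

(* pact X \<xi> y x h g is the restriction of g, over x, along h : y \<rightarrow> x. *)
record ('o, 'm, 'x, 'c, 'h, 'g) cpsh =
  pcar :: "('o, 'm, 'x \<times> 'c, 'g) ty"
  pact :: "'o \<Rightarrow> 'x \<Rightarrow> 'c \<Rightarrow> 'c \<Rightarrow> 'h \<Rightarrow> 'g \<Rightarrow> 'g"

(* Presheaves on the internal category CC, in context \<Xi>. *)
locale cat_presheaf = internal_category S CC + presheaf S \<Xi>
  for S :: "('o, 'm, 'z) cat_scheme" and CC :: "('o, 'm, 'c, 'h) icat"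
    and \<Xi> :: "('o, 'm, 'x) psh" and \<Gamma> :: "('o, 'm, 'x, 'c, 'h, 'g) cpsh" +
  assumes pcar: "type_over S (ctx_ob CC \<Xi>) (pcar \<Gamma>)"
    and pact_Fam: "X \<in> Ob S \<Longrightarrow> \<xi> \<in> At \<Xi> X \<Longrightarrow> y \<in> At (C0 CC) X \<Longrightarrow> x \<in> At (C0 CC) X \<Longrightarrow>
      h \<in> Fam (C1 CC) X (y, x) \<Longrightarrow> g \<in> Fam (pcar \<Gamma>) X (\<xi>, x) \<Longrightarrow>
      pact \<Gamma> X \<xi> y x h g \<in> Fam (pcar \<Gamma>) X (\<xi>, y)"
    and pact_Tr: "f \<in> Arr S \<Longrightarrow> \<xi> \<in> At \<Xi> (tgt S f) \<Longrightarrow>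
      y \<in> At (C0 CC) (tgt S f) \<Longrightarrow> x \<in> At (C0 CC) (tgt S f) \<Longrightarrow>
      h \<in> Fam (C1 CC) (tgt S f) (y, x) \<Longrightarrow> g \<in> Fam (pcar \<Gamma>) (tgt S f) (\<xi>, x) \<Longrightarrow>
      Tr (pcar \<Gamma>) f (\<xi>, y) (pact \<Gamma> (tgt S f) \<xi> y x h g) =
      pact \<Gamma> (src S f) (Rs \<Xi> f \<xi>) (Rs (C0 CC) f y) (Rs (C0 CC) f x)
        (Tr (C1 CC) f (y, x) h) (Tr (pcar \<Gamma>) f (\<xi>, x) g)"
    and pact_cid: "X \<in> Ob S \<Longrightarrow> \<xi> \<in> At \<Xi> X \<Longrightarrow> x \<in> At (C0 CC) X \<Longrightarrow>
      g \<in> Fam (pcar \<Gamma>) X (\<xi>, x) \<Longrightarrow> pact \<Gamma> X \<xi> x x (cid CC X x) g = g"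
    and pact_ccmp: "X \<in> Ob S \<Longrightarrow> \<xi> \<in> At \<Xi> X \<Longrightarrow>
      z \<in> At (C0 CC) X \<Longrightarrow> y \<in> At (C0 CC) X \<Longrightarrow> x \<in> At (C0 CC) X \<Longrightarrow>
      k \<in> Fam (C1 CC) X (z, y) \<Longrightarrow> h \<in> Fam (C1 CC) X (y, x) \<Longrightarrow> g \<in> Fam (pcar \<Gamma>) X (\<xi>, x) \<Longrightarrow>
      pact \<Gamma> X \<xi> z x (ccmp CC X z y x h k) g = pact \<Gamma> X \<xi> z y k (pact \<Gamma> X \<xi> y x h g)"

record ('o, 'm, 'x, 'c, 'h, 'g, 'a) cty =
  tcar :: "('o, 'm, ('x \<times> 'c) \<times> 'g, 'a) ty"
  tact :: "'o \<Rightarrow> 'x \<Rightarrow> 'c \<Rightarrow> 'c \<Rightarrow> 'h \<Rightarrow> 'g \<Rightarrow> 'a \<Rightarrow> 'a"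

(* Types over \<Gamma> in the presheaf model on CC, in context \<Xi>; pcar and tcar are the underlying
   C0-indexed families U \<Gamma> and U A. *)
locale cat_type = cat_presheaf S CC \<Xi> \<Gamma>
  for S :: "('o, 'm, 'z) cat_scheme" and CC :: "('o, 'm, 'c, 'h) icat"
    and \<Xi> :: "('o, 'm, 'x) psh" and \<Gamma> :: "('o, 'm, 'x, 'c, 'h, 'g) cpsh"
    and A :: "('o, 'm, 'x, 'c, 'h, 'g, 'a) cty" +
  assumes tcar: "type_over S (ext (ctx_ob CC \<Xi>) (pcar \<Gamma>)) (tcar A)"
    and tact_Fam: "X \<in> Ob S \<Longrightarrow> \<xi> \<in> At \<Xi> X \<Longrightarrow> y \<in> At (C0 CC) X \<Longrightarrow> x \<in> At (C0 CC) X \<Longrightarrow>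
      h \<in> Fam (C1 CC) X (y, x) \<Longrightarrow> g \<in> Fam (pcar \<Gamma>) X (\<xi>, x) \<Longrightarrow> a \<in> Fam (tcar A) X ((\<xi>, x), g) \<Longrightarrow>
      tact A X \<xi> y x h g a \<in> Fam (tcar A) X ((\<xi>, y), pact \<Gamma> X \<xi> y x h g)"
    and tact_Tr: "f \<in> Arr S \<Longrightarrow> \<xi> \<in> At \<Xi> (tgt S f) \<Longrightarrow>
      y \<in> At (C0 CC) (tgt S f) \<Longrightarrow> x \<in> At (C0 CC) (tgt S f) \<Longrightarrow>
      h \<in> Fam (C1 CC) (tgt S f) (y, x) \<Longrightarrow> g \<in> Fam (pcar \<Gamma>) (tgt S f) (\<xi>, x) \<Longrightarrow>
      a \<in> Fam (tcar A) (tgt S f) ((\<xi>, x), g) \<Longrightarrow>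
      Tr (tcar A) f ((\<xi>, y), pact \<Gamma> (tgt S f) \<xi> y x h g) (tact A (tgt S f) \<xi> y x h g a) =
      tact A (src S f) (Rs \<Xi> f \<xi>) (Rs (C0 CC) f y) (Rs (C0 CC) f x)
        (Tr (C1 CC) f (y, x) h) (Tr (pcar \<Gamma>) f (\<xi>, x) g) (Tr (tcar A) f ((\<xi>, x), g) a)"
    and tact_cid: "X \<in> Ob S \<Longrightarrow> \<xi> \<in> At \<Xi> X \<Longrightarrow> x \<in> At (C0 CC) X \<Longrightarrow>
      g \<in> Fam (pcar \<Gamma>) X (\<xi>, x) \<Longrightarrow> a \<in> Fam (tcar A) X ((\<xi>, x), g) \<Longrightarrow>
      tact A X \<xi> x x (cid CC X x) g a = a"
    and tact_ccmp: "X \<in> Ob S \<Longrightarrow> \<xi> \<in> At \<Xi> X \<Longrightarrow>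
      z \<in> At (C0 CC) X \<Longrightarrow> y \<in> At (C0 CC) X \<Longrightarrow> x \<in> At (C0 CC) X \<Longrightarrow>
      k \<in> Fam (C1 CC) X (z, y) \<Longrightarrow> h \<in> Fam (C1 CC) X (y, x) \<Longrightarrow>
      g \<in> Fam (pcar \<Gamma>) X (\<xi>, x) \<Longrightarrow> a \<in> Fam (tcar A) X ((\<xi>, x), g) \<Longrightarrow>
      tact A X \<xi> z x (ccmp CC X z y x h k) g a =
      tact A X \<xi> z y k (pact \<Gamma> X \<xi> y x h g) (tact A X \<xi> y x h g a)"

(* s is a map of presheaves on CC from \<Delta> to the substitution of \<Gamma> along t : \<Xi>' \<rightarrow> \<Xi>.
   For t the identity these are the maps \<Delta> \<rightarrow> \<Gamma> in one context; for s the identity they express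
   substitution of contexts.  An operation on sections that is stable under substitution is
   the same as a function in the internal language. *)
definition cat_presheaf_map ::
  "('o, 'm, 'z) cat_scheme \<Rightarrow> ('o, 'm, 'c, 'h) icat \<Rightarrow>
   ('o, 'm, 'y) psh \<Rightarrow> ('o, 'm, 'y, 'c, 'h, 'd) cpsh \<Rightarrow> ('o \<Rightarrow> 'y \<Rightarrow> 'x) \<Rightarrow>
   ('o, 'm, 'x, 'c, 'h, 'g) cpsh \<Rightarrow> ('o \<Rightarrow> 'y \<Rightarrow> 'c \<Rightarrow> 'd \<Rightarrow> 'g) \<Rightarrow> bool" where
  "cat_presheaf_map S CC \<Xi>' \<Delta> t \<Gamma> s \<longleftrightarrow>
     (\<forall>X\<in>Ob S. \<forall>\<xi>\<in>At \<Xi>' X. \<forall>x\<in>At (C0 CC) X. \<forall>d\<in>Fam (pcar \<Delta>) X (\<xi>, x).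
        s X \<xi> x d \<in> Fam (pcar \<Gamma>) X (t X \<xi>, x)) \<and>
     (\<forall>f\<in>Arr S. \<forall>\<xi>\<in>At \<Xi>' (tgt S f). \<forall>x\<in>At (C0 CC) (tgt S f). \<forall>d\<in>Fam (pcar \<Delta>) (tgt S f) (\<xi>, x).
        s (src S f) (Rs \<Xi>' f \<xi>) (Rs (C0 CC) f x) (Tr (pcar \<Delta>) f (\<xi>, x) d) =
        Tr (pcar \<Gamma>) f (t (tgt S f) \<xi>, x) (s (tgt S f) \<xi> x d)) \<and>
     (\<forall>X\<in>Ob S. \<forall>\<xi>\<in>At \<Xi>' X. \<forall>y\<in>At (C0 CC) X. \<forall>x\<in>At (C0 CC) X.
        \<forall>h\<in>Fam (C1 CC) X (y, x). \<forall>d\<in>Fam (pcar \<Delta>) X (\<xi>, x).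
        s X \<xi> y (pact \<Delta> X \<xi> y x h d) = pact \<Gamma> X (t X \<xi>) y x h (s X \<xi> x d))"

(* A' is the reindexing A[t, s] of A along such a map. *)
definition cat_type_reindexed ::
  "('o, 'm, 'z) cat_scheme \<Rightarrow> ('o, 'm, 'c, 'h) icat \<Rightarrow>
   ('o, 'm, 'y) psh \<Rightarrow> ('o, 'm, 'y, 'c, 'h, 'd) cpsh \<Rightarrow> ('o \<Rightarrow> 'y \<Rightarrow> 'x) \<Rightarrow>
   ('o \<Rightarrow> 'y \<Rightarrow> 'c \<Rightarrow> 'd \<Rightarrow> 'g) \<Rightarrow>
   ('o, 'm, 'x, 'c, 'h, 'g, 'a) cty \<Rightarrow> ('o, 'm, 'y, 'c, 'h, 'd, 'a) cty \<Rightarrow> bool" where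
  "cat_type_reindexed S CC \<Xi>' \<Delta> t s A A' \<longleftrightarrow>
     ty_eq S (ext (ctx_ob CC \<Xi>') (pcar \<Delta>)) (tcar A')
       (subst_ty S (\<lambda>X ((\<xi>, x), d). ((t X \<xi>, x), s X \<xi> x d)) (tcar A)) \<and>
     (\<forall>X\<in>Ob S. \<forall>\<xi>\<in>At \<Xi>' X. \<forall>y\<in>At (C0 CC) X. \<forall>x\<in>At (C0 CC) X.
        \<forall>h\<in>Fam (C1 CC) X (y, x). \<forall>d\<in>Fam (pcar \<Delta>) X (\<xi>, x). \<forall>a\<in>Fam (tcar A') X ((\<xi>, x), d).
        tact A' X \<xi> y x h d a = tact A X (t X \<xi>) y x h (s X \<xi> x d) a)"


section \<open>The three kinds of fibrancy structures\<close>

abbreviation ob_pairs :: "('o, 'm, 'c, 'h) icat \<Rightarrow> ('o, 'm, 'x, 'c \<times> 'c) ty" where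
  "ob_pairs CC \<equiv> const_ty (psh_prod (C0 CC) (C0 CC))"

abbreviation hom_fam ::
  "('o, 'm, 'z) cat_scheme \<Rightarrow> ('o, 'm, 'c, 'h) icat \<Rightarrow> ('o, 'm, 'x \<times> 'c \<times> 'c, 'h) ty" where
  "hom_fam S CC \<equiv> subst_ty S (\<lambda>X. snd) (C1 CC)"

definition fib_hom where
  "fib_hom S CC \<Xi> = fib S \<Xi> (ob_pairs CC) (hom_fam S CC)"

definition fib_hom_reindex where
  "fib_hom_reindex S CC \<Xi>' t = fib_reindex S t (\<lambda>X \<xi> xy. xy) \<Xi>' (ob_pairs CC) (hom_fam S CC)"

(* The model of C0-indexed families.  A family of fibrancy structures indexed by x : C0 is a
   section of a dependent product over C0, i.e. a fibrancy structure in the context extended by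
   x : C0; there the paths in the base have constant x. *)
definition fib_levelwise where
  "fib_levelwise S CC \<Xi> \<Gamma> A = fib S (ctx_ob CC \<Xi>) (pcar \<Gamma>) (tcar A)"

definition fib_levelwise_reindex where
  "fib_levelwise_reindex S CC \<Xi>' \<Delta> A' t s =
     fib_reindex S (\<lambda>X (\<xi>, x). (t X \<xi>, x)) (\<lambda>X (\<xi>, x). s X \<xi> x) (ctx_ob CC \<Xi>') (pcar \<Delta>) (tcar A')"

abbreviation total_ty ::
  "('o, 'm, 'c, 'h) icat \<Rightarrow> ('o, 'm, 'x, 'c, 'h, 'g) cpsh \<Rightarrow> ('o, 'm, 'x, 'c \<times> 'g) ty" where
  "total_ty CC \<Gamma> \<equiv> Sigma_ty (const_ty (C0 CC)) (pcar \<Gamma>)"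

abbreviation total_fam ::
  "('o, 'm, 'z) cat_scheme \<Rightarrow> ('o, 'm, 'x, 'c, 'h, 'g, 'a) cty \<Rightarrow> ('o, 'm, 'x \<times> 'c \<times> 'g, 'a) ty" where
  "total_fam S A \<equiv> subst_ty S (\<lambda>X (\<xi>, x, g). ((\<xi>, x), g)) (tcar A)"

(* U A as a single family over the total type of U \<Gamma>; paths in the base may vary x. *)
definition fib_total where
  "fib_total S CC \<Xi> \<Gamma> A = fib S \<Xi> (total_ty CC \<Gamma>) (total_fam S A)"

definition fib_total_reindex where
  "fib_total_reindex S CC \<Xi>' \<Delta> A' t s =
     fib_reindex S t (\<lambda>X \<xi> (x, d). (x, s X \<xi> x d)) \<Xi>' (total_ty CC \<Delta>) (total_fam S A')"

end

theory Submission
  imports Defs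
begin

text \<open>Given a path $(x, g)$ in the total type and a tube open at the endpoint $1 - e$, filling the
  identity at $x_{1-e}$ in the family of morphisms along $j \mapsto (x_{1-e}, x_{c(i, j)})$, where $c$ is a
  connection, yields morphisms $h_i : x_{1-e} \to x_i$ with $h_{1-e} = \mathrm{id}$.  Restricting the path
  and the tube along $h_i$ moves the whole problem into the fibre over the constant object
  $x_{1-e}$, where the levelwise structure solves it.  As $h_{1-e}$ is the identity, the solution
  lies in the required fibre and agrees with the given tube.\<close>

text \<open>The levelwise structure only accepts paths over a constant object, while a path in the
  total type may vary its object. Composition in the morphism family yields only the far end of a
  line, whereas a morphism is required for every \<open>i\<close>: the connection makes
  \<open>i\<close> that far end, and the face \<open>i = 1 - e\<close>, where the line is constant,
  forces the identity strictly, so that no correction is made afterwards.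

  Externally a path at stage \<open>X\<close> is indexed by pairs \<open>(f, i)\<close> with
  \<open>i\<close> an element at stage \<open>src S f\<close>. The morphism at \<open>(f, i)\<close>
  is found by restricting all data along \<open>f\<close> and filling at that stage; it is natural
  because fibrancy structures commute with restriction. It depends only on the objects of the path
  and on \<open>c\<close>, and maps of presheaves keep objects fixed and commute with the action.
  This is the source of naturality in the presheaf.\<close>

text \<open>As a function of \<open>j\<close>, \<open>contract S e X i j\<close> runs from the endpoint \<open>1 - e\<close> to \<open>i\<close>, and is constant
  if \<open>i\<close> is \<open>1 - e\<close>.\<close>

definition contract :: "('o, 'm, 'i, 'z) cube_base_scheme \<Rightarrow> bool \<Rightarrow> 'o \<Rightarrow> 'i \<Rightarrow> 'i \<Rightarrow> 'i" where
  "contract S e X i j = (if e then Meet S X i j else Join S X i j)"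

definition face :: "('o, 'm, 'i, 'z) cube_base_scheme \<Rightarrow> bool \<Rightarrow> 'o \<Rightarrow> 'i \<Rightarrow> 'm set" where
  "face S e X i = {f \<in> into S X. Rs (Itv S) f i = endpt S e (src S f)}"

text \<open>Here \<open>j\<close> is the path variable and \<open>i\<close> a parameter at stage
  \<open>X\<close>, restricted along \<open>g\<close> where it is used. The outer
  \<open>restrict\<close> matters: a fibrancy structure takes the path as a HOL function, so equal
  paths must also agree off the cylinder.\<close>

definition star_path ::
  "('o, 'm, 'i, 'z) cube_base_scheme \<Rightarrow> bool \<Rightarrow> 'o \<Rightarrow> ('m \<times> 'i \<Rightarrow> 'c) \<Rightarrow> 'i \<Rightarrow> 'm \<times> 'i \<Rightarrow> 'c \<times> 'c" where
  "star_path S e X x i = restrict (\<lambda>(g, j). (x (g, endpt S (\<not> e) (src S g)),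
     x (g, contract S e (src S g) (Rs (Itv S) g i) j))) (cyl S X)"

definition id_tube ::
  "('o, 'm, 'i, 'z) cube_base_scheme \<Rightarrow> ('o, 'm, 'c, 'h) icat \<Rightarrow> bool \<Rightarrow> 'o \<Rightarrow>
   ('m \<times> 'i \<Rightarrow> 'c) \<Rightarrow> 'i \<Rightarrow> 'm \<times> 'i \<Rightarrow> 'h" where
  "id_tube S CC e X x i = restrict (\<lambda>(g, j). cid CC (src S g) (x (g, endpt S (\<not> e) (src S g))))
     (tube S X (\<not> e) (face S (\<not> e) X i))"

text \<open>The direction is reversed: the composition starts at \<open>\<not> e\<close>, where the
  identity is prescribed, and ends at \<open>e\<close>, where the contraction has reached
  \<open>i\<close>.\<close>

definition hom_fill where
  "hom_fill S CC c X \<xi> e x i =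
     c (X, \<xi>, \<not> e, face S (\<not> e) X i, star_path S e X x i, id_tube S CC e X x i)"

definition ob_path ::
  "('o, 'm, 'i, 'z) cube_base_scheme \<Rightarrow> 'o \<Rightarrow> ('m \<times> 'i \<Rightarrow> 'c \<times> 'g) \<Rightarrow> 'm \<times> 'i \<Rightarrow> 'c" where
  "ob_path S X p = restrict (\<lambda>u. fst (p u)) (cyl S X)"

text \<open>In contrast to paths, this is not cut down to the cylinder. Such lines are therefore
  compared pointwise on the cylinder and never as functions.\<close>

definition hom_line where
  "hom_line S CC \<Xi> c X \<xi> e x =
     (\<lambda>(f, i). hom_fill S CC c (src S f) (Rs \<Xi> f \<xi>) e (path_pull S f x) i)"

definition act_path where
  "act_path S \<Xi> \<Gamma> X \<xi> e p H = restrict (\<lambda>(f, i).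
     pact \<Gamma> (src S f) (Rs \<Xi> f \<xi>) (fst (p (f, endpt S (\<not> e) (src S f)))) (fst (p (f, i)))
       (H (f, i)) (snd (p (f, i)))) (cyl S X)"

definition act_partial where
  "act_partial S \<Xi> A X \<xi> e \<phi> p H a = restrict (\<lambda>(f, i).
     tact A (src S f) (Rs \<Xi> f \<xi>) (fst (p (f, endpt S (\<not> e) (src S f)))) (fst (p (f, i)))
       (H (f, i)) (snd (p (f, i))) (a (f, i))) (tube S X e \<phi>)"

text \<open>The object at \<open>1 - e\<close> moves from the base path into the context point.
  There it is constant along the path, as a problem for the levelwise structure requires.\<close>

definition levelwise_problem where
  "levelwise_problem S CC \<Xi> c \<Gamma> A = (\<lambda>(X, \<xi>, e, \<phi>, p, a).
     let H = hom_line S CC \<Xi> c X \<xi> e (ob_path S X p)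
     in (X, (\<xi>, fst (p (idm S X, endpt S (\<not> e) X))), e, \<phi>,
         act_path S \<Xi> \<Gamma> X \<xi> e p H, act_partial S \<Xi> A X \<xi> e \<phi> p H a))"

definition total_comp where
  "total_comp S CC \<Xi> c \<Gamma> A b = restrict (\<lambda>u. b (levelwise_problem S CC \<Xi> c \<Gamma> A u))
     (fib_dom S \<Xi> (total_ty CC \<Gamma>) (total_fam S A))"

section \<open>Restriction along arrows of the site\<close>

context small_category
begin

lemma into_Arr: "f \<in> into S X \<Longrightarrow> f \<in> Arr S"
  by (simp add: into_def)

lemma into_src_Ob: "f \<in> into S X \<Longrightarrow> src S f \<in> Ob S"
  by (simp add: into_Arr src_Ob)

lemma idm_into: "X \<in> Ob S \<Longrightarrow> idm S X \<in> into S X"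
  by (simp add: into_def idm_Arr tgt_idm)

lemma cmp_into: "f \<in> into S X \<Longrightarrow> g \<in> into S (src S f) \<Longrightarrow> cmp S f g \<in> into S X"
  by (simp add: into_def cmp_Arr tgt_cmp)

lemma src_cmp_into: "f \<in> into S X \<Longrightarrow> g \<in> into S (src S f) \<Longrightarrow> src S (cmp S f g) = src S g"
  by (simp add: into_def src_cmp)

lemma cmp_assoc_into: "f \<in> into S X \<Longrightarrow> g \<in> into S (src S f) \<Longrightarrow> h \<in> into S (src S g) \<Longrightarrow>
    cmp S (cmp S f g) h = cmp S f (cmp S g h)"
  by (simp add: into_def cmp_assoc)

lemma cmp_idm_into: "f \<in> into S X \<Longrightarrow> cmp S f (idm S (src S f)) = f"
  by (simp add: into_def cmp_idm)

lemma idm_cmp_into: "f \<in> into S X \<Longrightarrow> cmp S (idm S X) f = f"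
  using idm_cmp[of f] by (simp add: into_def)

lemmas into_simps = cmp_into src_cmp_into cmp_assoc_into cmp_idm_into idm_cmp_into
  idm_into src_idm into_src_Ob

end

context presheaf
begin

lemma Rs_into: "f \<in> into S X \<Longrightarrow> x \<in> At P X \<Longrightarrow> Rs P f x \<in> At P (src S f)"
  using Rs_At[of f x] by (simp add: into_def)

lemma Rs_cmp_into: "f \<in> into S X \<Longrightarrow> g \<in> into S (src S f) \<Longrightarrow> x \<in> At P X \<Longrightarrow>
    Rs P (cmp S f g) x = Rs P g (Rs P f x)"
  using Rs_cmp[of f g x] by (simp add: into_def)

end

section \<open>Cylinders, tubes and composition problems under change of stage\<close>

context cubical_model
begin

sublocale interval: presheaf S "Itv S"
  by (rule Itv)

lemma cyl_iff: "(f, i) \<in> cyl S X \<longleftrightarrow> f \<in> into S X \<and> i \<in> At (Itv S) (src S f)"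
  by (simp add: cyl_def)

lemma tube_iff: "(f, i) \<in> tube S X e \<phi> \<longleftrightarrow>
    f \<in> into S X \<and> i \<in> At (Itv S) (src S f) \<and> (i = endpt S e (src S f) \<or> f \<in> \<phi>)"
  by (auto simp: tube_def cyl_def)

lemma endpt_into: "f \<in> into S X \<Longrightarrow> Rs (Itv S) f (endpt S e X) = endpt S e (src S f)"
  using endpt_Rs[of f e] by (simp add: into_def)

lemma sieve_pull_iff: "g \<in> sieve_pull S f \<phi> \<longleftrightarrow> g \<in> into S (src S f) \<and> cmp S f g \<in> \<phi>"
  by (simp add: sieve_pull_def)

lemma Cof_into: "X \<in> Ob S \<Longrightarrow> \<phi> \<in> Cof S X \<Longrightarrow> f \<in> \<phi> \<Longrightarrow> f \<in> into S X"
  and Cof_cmp: "X \<in> Ob S \<Longrightarrow> \<phi> \<in> Cof S X \<Longrightarrow> f \<in> \<phi> \<Longrightarrow> g \<in> into S (src S f) \<Longrightarrow> cmp S f g \<in> \<phi>"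
  using Cof_sieve unfolding sieves_def by blast+

text \<open>Endpoints are preserved by restriction and cofibrations are sieves, so both alternatives
  defining the tube survive.\<close>

lemma tube_cmp: "X \<in> Ob S \<Longrightarrow> \<phi> \<in> Cof S X \<Longrightarrow> (f, i) \<in> tube S X e \<phi> \<Longrightarrow> g \<in> into S (src S f) \<Longrightarrow>
    (cmp S f g, Rs (Itv S) g i) \<in> tube S X e \<phi>"
  by (auto simp: tube_iff into_simps interval.Rs_into endpt_into endpt_At intro: Cof_cmp)

lemma contract_At: "X \<in> Ob S \<Longrightarrow> i \<in> At (Itv S) X \<Longrightarrow> j \<in> At (Itv S) X \<Longrightarrow>
    contract S e X i j \<in> At (Itv S) X"
  by (simp add: contract_def Meet_At Join_At)

lemma contract_Rs: "f \<in> into S X \<Longrightarrow> i \<in> At (Itv S) X \<Longrightarrow> j \<in> At (Itv S) X \<Longrightarrow>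
    Rs (Itv S) f (contract S e X i j) =
    contract S e (src S f) (Rs (Itv S) f i) (Rs (Itv S) f j)"
  using Meet_Rs[of f i j] Join_Rs[of f i j] by (simp add: contract_def into_def)

text \<open>The first two equations make the identity well typed on both sides of the tube to be
  filled, \<open>j = 1 - e\<close> and \<open>i = 1 - e\<close>; the third identifies the far end of
  the filled line.\<close>

lemma contract_endpt:
  assumes "X \<in> Ob S" "i \<in> At (Itv S) X"
  shows "contract S e X i (endpt S (\<not> e) X) = endpt S (\<not> e) X"
    and "contract S e X (endpt S (\<not> e) X) i = endpt S (\<not> e) X"
    and "contract S e X i (endpt S e X) = i"
  using assms by (cases e;
    simp add: contract_def endpt_def Meet_Zero Meet_One Join_Zero Join_One)+

lemma face_Cof: "X \<in> Ob S \<Longrightarrow> i \<in> At (Itv S) X \<Longrightarrow> face S e X i \<in> Cof S X"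
  unfolding face_def by (rule Cof_endpt)

lemma face_pull: "f \<in> into S X \<Longrightarrow> i \<in> At (Itv S) X \<Longrightarrow>
    sieve_pull S f (face S e X i) = face S e (src S f) (Rs (Itv S) f i)"
  by (auto simp: face_def sieve_pull_def into_simps interval.Rs_cmp_into)

lemma paths_Fam: "p \<in> paths S \<Xi> \<Gamma> X \<xi> \<Longrightarrow> f \<in> into S X \<Longrightarrow> i \<in> At (Itv S) (src S f) \<Longrightarrow>
    p (f, i) \<in> Fam \<Gamma> (src S f) (Rs \<Xi> f \<xi>)"
  unfolding paths_def PiE_def Pi_def by (auto simp: cyl_iff)

lemma paths_Tr: "p \<in> paths S \<Xi> \<Gamma> X \<xi> \<Longrightarrow> f \<in> into S X \<Longrightarrow> i \<in> At (Itv S) (src S f) \<Longrightarrow>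
    g \<in> into S (src S f) \<Longrightarrow>
    p (cmp S f g, Rs (Itv S) g i) = Tr \<Gamma> g (Rs \<Xi> f \<xi>) (p (f, i))"
  unfolding paths_def by (fastforce simp: cyl_iff)

lemma restrict_paths:
  assumes "\<And>f i. f \<in> into S X \<Longrightarrow> i \<in> At (Itv S) (src S f) \<Longrightarrow> p (f, i) \<in> Fam \<Gamma> (src S f) (Rs \<Xi> f \<xi>)"
    and "\<And>f i g. f \<in> into S X \<Longrightarrow> i \<in> At (Itv S) (src S f) \<Longrightarrow> g \<in> into S (src S f) \<Longrightarrow>
      p (cmp S f g, Rs (Itv S) g i) = Tr \<Gamma> g (Rs \<Xi> f \<xi>) (p (f, i))"
  shows "restrict p (cyl S X) \<in> paths S \<Xi> \<Gamma> X \<xi>"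
  using assms by (auto simp: paths_def cyl_iff into_simps interval.Rs_into)

lemma partials_Fam: "a \<in> partials S \<Xi> A X \<xi> e \<phi> p \<Longrightarrow> (f, i) \<in> tube S X e \<phi> \<Longrightarrow>
    a (f, i) \<in> Fam A (src S f) (Rs \<Xi> f \<xi>, p (f, i))"
  unfolding partials_def PiE_def Pi_def by auto

lemma partials_Tr: "a \<in> partials S \<Xi> A X \<xi> e \<phi> p \<Longrightarrow> (f, i) \<in> tube S X e \<phi> \<Longrightarrow>
    g \<in> into S (src S f) \<Longrightarrow>
    a (cmp S f g, Rs (Itv S) g i) = Tr A g (Rs \<Xi> f \<xi>, p (f, i)) (a (f, i))"
  unfolding partials_def by auto

lemma restrict_partials:
  assumes "X \<in> Ob S" "\<phi> \<in> Cof S X"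
    and "\<And>f i. (f, i) \<in> tube S X e \<phi> \<Longrightarrow> a (f, i) \<in> Fam A (src S f) (Rs \<Xi> f \<xi>, p (f, i))"
    and "\<And>f i g. (f, i) \<in> tube S X e \<phi> \<Longrightarrow> g \<in> into S (src S f) \<Longrightarrow>
      a (cmp S f g, Rs (Itv S) g i) = Tr A g (Rs \<Xi> f \<xi>, p (f, i)) (a (f, i))"
  shows "restrict a (tube S X e \<phi>) \<in> partials S \<Xi> A X \<xi> e \<phi> p"
  using assms by (auto simp: partials_def tube_cmp)

lemma fib_dom_iff: "(X, \<xi>, e, \<phi>, p, a) \<in> fib_dom S \<Xi> \<Gamma> A \<longleftrightarrow> X \<in> Ob S \<and> \<xi> \<in> At \<Xi> X \<and>
    \<phi> \<in> Cof S X \<and> p \<in> paths S \<Xi> \<Gamma> X \<xi> \<and> a \<in> partials S \<Xi> A X \<xi> e \<phi> p"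
  by (simp add: fib_dom_def)

lemma path_pull_apply: "g \<in> into S (src S f) \<Longrightarrow> i \<in> At (Itv S) (src S g) \<Longrightarrow>
    path_pull S f p (g, i) = p (cmp S f g, i)"
  by (simp add: path_pull_def cyl_iff)

lemma path_pull_cmp: "f \<in> into S X \<Longrightarrow> g \<in> into S (src S f) \<Longrightarrow>
    path_pull S (cmp S f g) p = path_pull S g (path_pull S f p)"
  by (auto simp: path_pull_def cyl_iff into_simps fun_eq_iff restrict_def)

lemma path_pull_paths:
  assumes "presheaf S \<Xi>" "\<xi> \<in> At \<Xi> X" "p \<in> paths S \<Xi> \<Gamma> X \<xi>" "f \<in> into S X"
  shows "path_pull S f p \<in> paths S \<Xi> \<Gamma> (src S f) (Rs \<Xi> f \<xi>)"
proof -
  interpret base: presheaf S \<Xi> by fact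
  show ?thesis unfolding path_pull_def
    using assms paths_Fam[OF assms(3)] paths_Tr[OF assms(3)]
    by (intro restrict_paths)
      (auto simp: into_simps simp flip: base.Rs_cmp_into cmp_assoc_into split: prod.splits,
       metis cmp_into src_cmp_into base.Rs_cmp_into)
qed

text \<open>The naturality clause of \<open>fib\<close> evaluates a structure at the restricted
  problem. A structure defined by \<open>restrict\<close> has its intended value there only if that
  problem is again in the domain.\<close>

lemma fib_dom_pull:
  assumes "presheaf S \<Xi>" "(X, \<xi>, e, \<phi>, p, a) \<in> fib_dom S \<Xi> \<Gamma> A" "f \<in> into S X"
  shows "(src S f, Rs \<Xi> f \<xi>, e, sieve_pull S f \<phi>, path_pull S f p, partial_pull S f e \<phi> a)
    \<in> fib_dom S \<Xi> \<Gamma> A"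
proof -
  interpret base: presheaf S \<Xi> by fact
  have d: "X \<in> Ob S" "\<xi> \<in> At \<Xi> X" "\<phi> \<in> Cof S X" "p \<in> paths S \<Xi> \<Gamma> X \<xi>"
    "a \<in> partials S \<Xi> A X \<xi> e \<phi> p"
    using assms(2) by (simp_all add: fib_dom_iff)
  have cof: "sieve_pull S f \<phi> \<in> Cof S (src S f)"
    using Cof_pull[of f \<phi>] assms(3) d by (simp add: into_def)
  have tube: "(cmp S f g, i) \<in> tube S X e \<phi>"
    if "(g, i) \<in> tube S (src S f) e (sieve_pull S f \<phi>)" for g i
    using that assms(3) by (auto simp: tube_iff into_simps sieve_pull_iff)
  have "partial_pull S f e \<phi> a
    \<in> partials S \<Xi> A (src S f) (Rs \<Xi> f \<xi>) e (sieve_pull S f \<phi>) (path_pull S f p)"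
    unfolding partial_pull_def
  proof (rule restrict_partials, goal_cases)
    case (3 g i)
    then have "g \<in> into S (src S f)" "i \<in> At (Itv S) (src S g)" by (auto simp: tube_iff)
    then show ?case
      using partials_Fam[OF d(5) tube[OF 3]] assms(3) d(2)
      by (simp add: path_pull_apply base.Rs_cmp_into src_cmp_into)
  next
    case (4 g i h)
    then have "g \<in> into S (src S f)" "i \<in> At (Itv S) (src S g)" by (auto simp: tube_iff)
    then show ?case
      using partials_Tr[OF d(5) tube[OF 4(1)], of h] 4(2) assms(3) d(2)
      by (simp add: path_pull_apply base.Rs_cmp_into into_simps)
  qed (use assms(3) cof in \<open>auto simp: into_src_Ob\<close>)
  then show ?thesis
    using d assms path_pull_paths[OF assms(1) d(2,4) assms(3)] cof
    by (simp add: fib_dom_iff base.Rs_into into_src_Ob)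
qed

lemma fib_Fam: "c \<in> fib S \<Xi> \<Gamma> A \<Longrightarrow> (X, \<xi>, e, \<phi>, p, a) \<in> fib_dom S \<Xi> \<Gamma> A \<Longrightarrow>
    c (X, \<xi>, e, \<phi>, p, a) \<in> Fam A X (\<xi>, p (idm S X, endpt S (\<not> e) X))"
  unfolding fib_def PiE_def Pi_def by fastforce

lemma fib_agrees: "c \<in> fib S \<Xi> \<Gamma> A \<Longrightarrow> (X, \<xi>, e, \<phi>, p, a) \<in> fib_dom S \<Xi> \<Gamma> A \<Longrightarrow> f \<in> \<phi> \<Longrightarrow>
    Tr A f (\<xi>, p (idm S X, endpt S (\<not> e) X)) (c (X, \<xi>, e, \<phi>, p, a)) =
    a (f, endpt S (\<not> e) (src S f))"
  unfolding fib_def by fastforce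

lemma fib_Tr: "c \<in> fib S \<Xi> \<Gamma> A \<Longrightarrow> (X, \<xi>, e, \<phi>, p, a) \<in> fib_dom S \<Xi> \<Gamma> A \<Longrightarrow> f \<in> into S X \<Longrightarrow>
    Tr A f (\<xi>, p (idm S X, endpt S (\<not> e) X)) (c (X, \<xi>, e, \<phi>, p, a)) =
    c (src S f, Rs \<Xi> f \<xi>, e, sieve_pull S f \<phi>, path_pull S f p, partial_pull S f e \<phi> a)"
  unfolding fib_def by fastforce

end


section \<open>Lines of morphisms obtained by filling the identity\<close>

locale cubical_category = cubical_model S tx ta + internal_category S CC
  for S :: "('o, 'm, 'i, 'z) cube_base_scheme" and tx :: "'u itself" and ta :: "'v itself"
    and CC :: "('o, 'm, 'c, 'h) icat"
begin

sublocale C0: presheaf S "C0 CC"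
  by (rule C0)

lemma ob_path_At: "x \<in> paths S \<Xi> (const_ty (C0 CC)) X \<xi> \<Longrightarrow> f \<in> into S X \<Longrightarrow>
    i \<in> At (Itv S) (src S f) \<Longrightarrow> x (f, i) \<in> At (C0 CC) (src S f)"
  using paths_Fam[of x \<Xi> "const_ty (C0 CC)"] by (simp add: const_ty_def)

lemma ob_path_Rs: "x \<in> paths S \<Xi> (const_ty (C0 CC)) X \<xi> \<Longrightarrow> f \<in> into S X \<Longrightarrow>
    i \<in> At (Itv S) (src S f) \<Longrightarrow> g \<in> into S (src S f) \<Longrightarrow>
    x (cmp S f g, Rs (Itv S) g i) = Rs (C0 CC) g (x (f, i))"
  using paths_Tr[of x \<Xi> "const_ty (C0 CC)"] by (simp add: const_ty_def)

lemma ob_path_endpt: "x \<in> paths S \<Xi> (const_ty (C0 CC)) X \<xi> \<Longrightarrow> f \<in> into S X \<Longrightarrow>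
    g \<in> into S (src S f) \<Longrightarrow>
    x (cmp S f g, endpt S e (src S g)) = Rs (C0 CC) g (x (f, endpt S e (src S f)))"
  using ob_path_Rs[of x \<Xi> X \<xi> f "endpt S e (src S f)" g]
  by (simp add: endpt_into endpt_At into_src_Ob)

lemma hom_fam_simps:
  "Fam (hom_fam S CC) X (\<xi>, u) = Fam (C1 CC) X u"
  "Tr (hom_fam S CC) f (\<xi>, u) = Tr (C1 CC) f u"
  by (simp_all add: subst_ty_def)

lemma ob_pairs_simps:
  "Fam (ob_pairs CC) X \<xi> = At (C0 CC) X \<times> At (C0 CC) X"
  "Tr (ob_pairs CC) f \<xi> (u, v) = (Rs (C0 CC) f u, Rs (C0 CC) f v)"
  by (simp_all add: const_ty_def psh_prod_def)

lemma cid_Tr_into: "f \<in> into S X \<Longrightarrow> x \<in> At (C0 CC) X \<Longrightarrow>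
    Tr (C1 CC) f (x, x) (cid CC X x) = cid CC (src S f) (Rs (C0 CC) f x)"
  using cid_Tr[of f x] by (simp add: into_def)

text \<open>On the tube either \<open>j\<close> or the restriction of \<open>i\<close> is the
  endpoint \<open>1 - e\<close>. In both cases the contraction is \<open>1 - e\<close>, so source
  and target of the required morphism coincide and the identity fits.\<close>

lemma hom_fill_dom:
  assumes "presheaf S \<Xi>" "X \<in> Ob S" "\<xi> \<in> At \<Xi> X" "x \<in> paths S \<Xi> (const_ty (C0 CC)) X \<xi>"
    and "i \<in> At (Itv S) X"
  shows "(X, \<xi>, \<not> e, face S (\<not> e) X i, star_path S e X x i, id_tube S CC e X x i)
    \<in> fib_dom S \<Xi> (ob_pairs CC) (hom_fam S CC)"
proof -
  have con: "contract S e (src S g) (Rs (Itv S) g i) j \<in> At (Itv S) (src S g)"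
    if "g \<in> into S X" "j \<in> At (Itv S) (src S g)" for g j
    using that assms by (simp add: contract_At into_src_Ob interval.Rs_into)
  have "star_path S e X x i \<in> paths S \<Xi> (ob_pairs CC) X \<xi>"
    unfolding star_path_def
  proof (rule restrict_paths, goal_cases)
    case (1 g j)
    then show ?case
      by (simp add: ob_pairs_simps ob_path_At[OF assms(4)] con endpt_At into_src_Ob)
  next
    case (2 g j k)
    then show ?case
      using ob_path_Rs[OF assms(4) 2(1) con[OF 2(1,2)] 2(3)] assms(5)
        contract_Rs[OF 2(3), of "Rs (Itv S) g i" j e]
      by (simp add: ob_pairs_simps ob_path_endpt[OF assms(4)] into_simps
          interval.Rs_cmp_into interval.Rs_into)
  qed
  moreover have "id_tube S CC e X x i
      \<in> partials S \<Xi> (hom_fam S CC) X \<xi> (\<not> e) (face S (\<not> e) X i) (star_path S e X x i)"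
    unfolding id_tube_def
  proof (rule restrict_partials, goal_cases)
    case (3 g j)
    then have g: "g \<in> into S X" "j \<in> At (Itv S) (src S g)"
      "j = endpt S (\<not> e) (src S g) \<or> Rs (Itv S) g i = endpt S (\<not> e) (src S g)"
      by (auto simp: tube_iff face_def)
    then have "contract S e (src S g) (Rs (Itv S) g i) j = endpt S (\<not> e) (src S g)"
      using contract_endpt[of "src S g"] assms(5) by (auto simp: into_src_Ob interval.Rs_into)
    then show ?case
      using g by (simp add: hom_fam_simps star_path_def cyl_iff cid_Fam into_src_Ob endpt_At
          ob_path_At[OF assms(4)])
  next
    case (4 g j k)
    then have g: "g \<in> into S X" "j \<in> At (Itv S) (src S g)"
      "j = endpt S (\<not> e) (src S g) \<or> Rs (Itv S) g i = endpt S (\<not> e) (src S g)"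
      by (auto simp: tube_iff face_def)
    then have "contract S e (src S g) (Rs (Itv S) g i) j = endpt S (\<not> e) (src S g)"
      using contract_endpt[of "src S g"] assms(5) by (auto simp: into_src_Ob interval.Rs_into)
    then show ?case
      using g 4 by (simp add: hom_fam_simps star_path_def cyl_iff into_simps endpt_At
          ob_path_endpt[OF assms(4)] ob_path_At[OF assms(4)] cid_Tr_into)
  qed (use assms in \<open>auto simp: face_Cof\<close>)
  ultimately show ?thesis
    using assms by (simp add: fib_dom_iff face_Cof)
qed

text \<open>With \<open>id_tube_pull\<close>, this makes the filling problem commute with change of
  stage, the parameter \<open>i\<close> being restricted along with the path. Naturality of the
  filler then follows from \<open>fib_Tr\<close>.\<close>

lemma star_path_pull:
  assumes "f \<in> into S X" "i \<in> At (Itv S) X"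
  shows "path_pull S f (star_path S e X x i) =
    star_path S e (src S f) (path_pull S f x) (Rs (Itv S) f i)"
  using assms
  by (auto simp: fun_eq_iff path_pull_def star_path_def restrict_def cyl_iff into_simps
      interval.Rs_cmp_into interval.Rs_into contract_At endpt_At)

lemma id_tube_pull:
  assumes "f \<in> into S X" "i \<in> At (Itv S) X"
  shows "partial_pull S f (\<not> e) (face S (\<not> e) X i) (id_tube S CC e X x i) =
    id_tube S CC e (src S f) (path_pull S f x) (Rs (Itv S) f i)"
  using assms
  by (auto simp: fun_eq_iff path_pull_def partial_pull_def id_tube_def restrict_def cyl_iff
      into_simps face_pull tube_iff endpt_At)
    (auto simp: face_def into_simps interval.Rs_cmp_into)

lemma hom_fill_Fam:
  assumes "presheaf S \<Xi>" "X \<in> Ob S" "\<xi> \<in> At \<Xi> X" "x \<in> paths S \<Xi> (const_ty (C0 CC)) X \<xi>"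
    and "i \<in> At (Itv S) X" and c: "c \<in> fib_hom S CC \<Xi>"
  shows "hom_fill S CC c X \<xi> e x i
      \<in> Fam (C1 CC) X (x (idm S X, endpt S (\<not> e) X), x (idm S X, i))"
    and "f \<in> into S X \<Longrightarrow>
      Tr (C1 CC) f (x (idm S X, endpt S (\<not> e) X), x (idm S X, i)) (hom_fill S CC c X \<xi> e x i) =
      hom_fill S CC c (src S f) (Rs \<Xi> f \<xi>) e (path_pull S f x) (Rs (Itv S) f i)"
    and "i = endpt S (\<not> e) X \<Longrightarrow>
      hom_fill S CC c X \<xi> e x i = cid CC X (x (idm S X, endpt S (\<not> e) X))"
proof -
  note dom = hom_fill_dom[OF assms(1-5), of e]
  note c' = c[unfolded fib_hom_def]
  \<comment> \<open>The problem is posed at \<open>\<not> e\<close>, so its answer lies over the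
    endpoint \<open>\<not> \<not> e\<close>, where \<open>contract\<close> returns
    \<open>i\<close>.\<close>
  have star: "star_path S e X x i (idm S X, endpt S (\<not> \<not> e) X) =
      (x (idm S X, endpt S (\<not> e) X), x (idm S X, i))"
    using assms by (simp add: star_path_def cyl_iff into_simps endpt_At interval.Rs_idm
        contract_endpt)
  show Fam: "hom_fill S CC c X \<xi> e x i
      \<in> Fam (C1 CC) X (x (idm S X, endpt S (\<not> e) X), x (idm S X, i))"
    using fib_Fam[OF c' dom] unfolding star by (simp add: hom_fam_simps hom_fill_def)
  show "Tr (C1 CC) f (x (idm S X, endpt S (\<not> e) X), x (idm S X, i)) (hom_fill S CC c X \<xi> e x i) =
      hom_fill S CC c (src S f) (Rs \<Xi> f \<xi>) e (path_pull S f x) (Rs (Itv S) f i)"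
    if "f \<in> into S X"
    using fib_Tr[OF c' dom that] assms(5) that unfolding star
    by (simp add: hom_fam_simps hom_fill_def face_pull star_path_pull id_tube_pull)
  assume i: "i = endpt S (\<not> e) X"
  then have face: "idm S X \<in> face S (\<not> e) X i"
    using assms(2,5) by (simp add: face_def into_simps interval.Rs_idm)
  have "x (idm S X, j) \<in> At (C0 CC) X" if "j \<in> At (Itv S) X" for j
    using ob_path_At[OF assms(4), of "idm S X" j] that assms(2) by (simp add: into_simps)
  \<comment> \<open>Agreement with the tube is an equation after restriction along an arrow of the
    face. The face is now maximal, so the identity arrow may be taken, and restriction along it
    disappears.\<close>
  then have "Tr (C1 CC) (idm S X) (x (idm S X, endpt S (\<not> e) X), x (idm S X, i))
      (hom_fill S CC c X \<xi> e x i) = hom_fill S CC c X \<xi> e x i"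
    using type_over.Tr_idm[OF C1 assms(2) _ Fam] assms(2,5) by (simp add: psh_prod_def endpt_At)
  then show "hom_fill S CC c X \<xi> e x i = cid CC X (x (idm S X, endpt S (\<not> e) X))"
    using fib_agrees[OF c' dom face] face assms(2) unfolding star
    by (simp add: hom_fam_simps hom_fill_def id_tube_def tube_iff into_simps endpt_At)
qed

text \<open>This is all that the transport uses about the morphisms: typing, naturality and the
  identity at \<open>1 - e\<close>. Separating it from \<open>c\<close> allows a line to be replaced
  by one that agrees with it on the cylinder.\<close>

definition is_hom_line where
  "is_hom_line X e x H \<longleftrightarrow> (\<forall>f\<in>into S X. \<forall>i\<in>At (Itv S) (src S f).
     H (f, i) \<in> Fam (C1 CC) (src S f) (x (f, endpt S (\<not> e) (src S f)), x (f, i)) \<and>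
     (\<forall>g\<in>into S (src S f). H (cmp S f g, Rs (Itv S) g i) =
        Tr (C1 CC) g (x (f, endpt S (\<not> e) (src S f)), x (f, i)) (H (f, i))) \<and>
     (i = endpt S (\<not> e) (src S f) \<longrightarrow> H (f, i) = cid CC (src S f) (x (f, i))))"

lemma is_hom_lineI:
  assumes "presheaf S \<Xi>" "\<xi> \<in> At \<Xi> X" "x \<in> paths S \<Xi> (const_ty (C0 CC)) X \<xi>"
    and "c \<in> fib_hom S CC \<Xi>"
  shows "is_hom_line X e x (hom_line S CC \<Xi> c X \<xi> e x)"
  unfolding is_hom_line_def
proof (intro ballI, goal_cases)
  case (1 f i)
  interpret base: presheaf S \<Xi> by fact
  note fill = hom_fill_Fam[OF assms(1) into_src_Ob[OF 1(1)] base.Rs_into[OF 1(1) assms(2)]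
      path_pull_paths[OF assms(1,2,3) 1(1)] 1(2) assms(4), where e = e]
  have pull: "path_pull S f x (idm S (src S f), j) = x (f, j)" if "j \<in> At (Itv S) (src S f)" for j
    using that 1 by (simp add: path_pull_apply into_simps)
  show ?case
    using fill 1 assms(2)
    by (auto simp: hom_line_def pull endpt_At into_simps base.Rs_cmp_into path_pull_cmp)
qed

text \<open>Since \<open>hom_line\<close> restricts its data along the arrow before filling, this is
  functoriality of restriction alone and holds for any \<open>c\<close>.\<close>

lemma hom_line_pull:
  assumes "presheaf S \<Xi>" "\<xi> \<in> At \<Xi> X" "f \<in> into S X" "g \<in> into S (src S f)"
  shows "hom_line S CC \<Xi> c (src S f) (Rs \<Xi> f \<xi>) e (path_pull S f x) (g, i) =
    hom_line S CC \<Xi> c X \<xi> e x (cmp S f g, i)"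
proof -
  interpret base: presheaf S \<Xi> by fact
  show ?thesis
    using assms by (simp add: hom_line_def into_simps base.Rs_cmp_into path_pull_cmp)
qed

text \<open>Neither objects nor morphisms of \<open>CC\<close> depend on the context, so reindexing
  only changes the context point at which \<open>c\<close> is evaluated, and \<open>t\<close>
  commutes with restricting that point.\<close>

lemma hom_line_reindex:
  assumes "presheaf S \<Xi>'" "psh_map S \<Xi>' \<Xi> t" "\<xi> \<in> At \<Xi>' X"
    and "x \<in> paths S \<Xi>' (const_ty (C0 CC)) X \<xi>" "(f, i) \<in> cyl S X"
  shows "hom_line S CC \<Xi>' (fib_hom_reindex S CC \<Xi>' t c) X \<xi> e x (f, i) =
    hom_line S CC \<Xi> c X (t X \<xi>) e x (f, i)"
proof -
  interpret base: presheaf S \<Xi>' by fact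
  have f: "f \<in> into S X" "i \<in> At (Itv S) (src S f)"
    using assms(5) by (simp_all add: cyl_iff)
  have "t (src S f) (Rs \<Xi>' f \<xi>) = Rs \<Xi> f (t X \<xi>)"
    using assms(2,3) f(1) by (auto simp: psh_map_def into_def)
  \<comment> \<open>\<open>fib_reindex\<close> rebuilds the path on the cylinder; as
    \<open>star_path\<close> is already extensional, this returns the same function.\<close>
  moreover have "restrict (\<lambda>(g, j). star_path S e Y y k (g, j)) (cyl S Y) = star_path S e Y y k"
    for Y and y :: "'m \<times> 'i \<Rightarrow> 'c" and k
    by (simp add: star_path_def fun_eq_iff)
  ultimately show ?thesis
    using hom_fill_dom[OF assms(1) into_src_Ob[OF f(1)] base.Rs_into[OF f(1) assms(3)]
        path_pull_paths[OF assms(1,3,4) f(1)] f(2), of e]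
    by (simp add: hom_line_def hom_fill_def fib_hom_reindex_def fib_reindex_def)
qed

end


section \<open>Transport of a problem over the total type into the fibre of one object\<close>

lemma total_simps:
  "Fam (total_ty CC \<Gamma>) X \<xi> = (SIGMA x:At (C0 CC) X. Fam (pcar \<Gamma>) X (\<xi>, x))"
  "Tr (total_ty CC \<Gamma>) f \<xi> u = (Rs (C0 CC) f (fst u), Tr (pcar \<Gamma>) f (\<xi>, fst u) (snd u))"
  "Fam (total_fam S A) X (\<xi>, u) = Fam (tcar A) X ((\<xi>, fst u), snd u)"
  "Tr (total_fam S A) f (\<xi>, u) = Tr (tcar A) f ((\<xi>, fst u), snd u)"
  by (simp_all add: Sigma_ty_def const_ty_def subst_ty_def split: prod.splits)

lemma ctx_ob_simps:
  "At (ctx_ob CC \<Xi>) X = At \<Xi> X \<times> At (C0 CC) X"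
  "Rs (ctx_ob CC \<Xi>) f (\<xi>, x) = (Rs \<Xi> f \<xi>, Rs (C0 CC) f x)"
  by (simp_all add: ext_def const_ty_def)

locale cubical_cat_type = cubical_category S tx ta CC + cat_type S CC \<Xi> \<Gamma> A
  for S :: "('o, 'm, 'i, 'z) cube_base_scheme" and tx :: "'u itself" and ta :: "'v itself"
    and CC :: "('o, 'm, 'c, 'h) icat" and \<Xi> :: "('o, 'm, 'x) psh"
    and \<Gamma> :: "('o, 'm, 'x, 'c, 'h, 'g) cpsh" and A :: "('o, 'm, 'x, 'c, 'h, 'g, 'a) cty"
begin

lemma presheaf_base: "presheaf S \<Xi>"
  by unfold_locales

lemma pact_Tr_into: "f \<in> into S X \<Longrightarrow> \<xi> \<in> At \<Xi> X \<Longrightarrow>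
    y \<in> At (C0 CC) X \<Longrightarrow> x \<in> At (C0 CC) X \<Longrightarrow>
    h \<in> Fam (C1 CC) X (y, x) \<Longrightarrow> g \<in> Fam (pcar \<Gamma>) X (\<xi>, x) \<Longrightarrow>
    Tr (pcar \<Gamma>) f (\<xi>, y) (pact \<Gamma> X \<xi> y x h g) =
    pact \<Gamma> (src S f) (Rs \<Xi> f \<xi>) (Rs (C0 CC) f y) (Rs (C0 CC) f x)
      (Tr (C1 CC) f (y, x) h) (Tr (pcar \<Gamma>) f (\<xi>, x) g)"
  using pact_Tr[of f] by (simp add: into_def)

lemma tact_Tr_into: "f \<in> into S X \<Longrightarrow> \<xi> \<in> At \<Xi> X \<Longrightarrow>
    y \<in> At (C0 CC) X \<Longrightarrow> x \<in> At (C0 CC) X \<Longrightarrow>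
    h \<in> Fam (C1 CC) X (y, x) \<Longrightarrow> g \<in> Fam (pcar \<Gamma>) X (\<xi>, x) \<Longrightarrow>
    a \<in> Fam (tcar A) X ((\<xi>, x), g) \<Longrightarrow>
    Tr (tcar A) f ((\<xi>, y), pact \<Gamma> X \<xi> y x h g) (tact A X \<xi> y x h g a) =
    tact A (src S f) (Rs \<Xi> f \<xi>) (Rs (C0 CC) f y) (Rs (C0 CC) f x)
      (Tr (C1 CC) f (y, x) h) (Tr (pcar \<Gamma>) f (\<xi>, x) g) (Tr (tcar A) f ((\<xi>, x), g) a)"
  using tact_Tr[of f] by (simp add: into_def)

context
  fixes X \<xi> e \<phi> p a
  assumes dom: "(X, \<xi>, e, \<phi>, p, a) \<in> fib_dom S \<Xi> (total_ty CC \<Gamma>) (total_fam S A)"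
begin

lemma total_domD: "X \<in> Ob S" "\<xi> \<in> At \<Xi> X" "\<phi> \<in> Cof S X" "p \<in> paths S \<Xi> (total_ty CC \<Gamma>) X \<xi>"
    "a \<in> partials S \<Xi> (total_fam S A) X \<xi> e \<phi> p"
  using dom by (simp_all add: fib_dom_iff)

lemma total_path_Fam:
  assumes "f \<in> into S X" "i \<in> At (Itv S) (src S f)"
  shows "fst (p (f, i)) \<in> At (C0 CC) (src S f)"
    and "snd (p (f, i)) \<in> Fam (pcar \<Gamma>) (src S f) (Rs \<Xi> f \<xi>, fst (p (f, i)))"
  using paths_Fam[OF total_domD(4) assms] by (auto simp: total_simps)

lemma total_path_Tr: "f \<in> into S X \<Longrightarrow> i \<in> At (Itv S) (src S f) \<Longrightarrow> g \<in> into S (src S f) \<Longrightarrow>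
    p (cmp S f g, Rs (Itv S) g i) = (Rs (C0 CC) g (fst (p (f, i))),
      Tr (pcar \<Gamma>) g (Rs \<Xi> f \<xi>, fst (p (f, i))) (snd (p (f, i))))"
  using paths_Tr[OF total_domD(4)] by (simp add: total_simps)

lemma total_path_endpt: "f \<in> into S X \<Longrightarrow> g \<in> into S (src S f) \<Longrightarrow>
    fst (p (cmp S f g, endpt S e' (src S g))) = Rs (C0 CC) g (fst (p (f, endpt S e' (src S f))))"
  using total_path_Tr[of f "endpt S e' (src S f)" g] by (simp add: endpt_into endpt_At into_src_Ob)

text \<open>Matches the object stored in the extended context, which gets restricted along
  \<open>f\<close>, with the domain of the morphisms at \<open>(f, i)\<close>.\<close>

lemma total_path_vertex: "f \<in> into S X \<Longrightarrow>
    Rs (C0 CC) f (fst (p (idm S X, endpt S e' X))) = fst (p (f, endpt S e' (src S f)))"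
  using total_path_endpt[of "idm S X" f e'] total_domD(1) by (simp add: into_simps)

lemma total_partial_Fam: "(f, i) \<in> tube S X e \<phi> \<Longrightarrow>
    a (f, i) \<in> Fam (tcar A) (src S f) ((Rs \<Xi> f \<xi>, fst (p (f, i))), snd (p (f, i)))"
  using partials_Fam[OF total_domD(5)] by (simp add: total_simps)

lemma total_partial_Tr: "(f, i) \<in> tube S X e \<phi> \<Longrightarrow> g \<in> into S (src S f) \<Longrightarrow>
    a (cmp S f g, Rs (Itv S) g i) =
    Tr (tcar A) g ((Rs \<Xi> f \<xi>, fst (p (f, i))), snd (p (f, i))) (a (f, i))"
  using partials_Tr[OF total_domD(5)] by (simp add: total_simps)

text \<open>A path in a constant type does not mention the context. With \<open>\<Xi>'\<close> and
  \<open>\<xi>'\<close> left free, one path of objects can serve over both contexts in the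
  reindexing argument.\<close>

lemma ob_path_paths: "ob_path S X p \<in> paths S \<Xi>' (const_ty (C0 CC)) X \<xi>'"
  unfolding ob_path_def
  by (rule restrict_paths) (simp_all add: const_ty_def total_path_Fam total_path_Tr)

context
  fixes H
  assumes line: "is_hom_line X e (ob_path S X p) H"
begin

lemma
  assumes "f \<in> into S X" "i \<in> At (Itv S) (src S f)"
  shows line_Fam: "H (f, i) \<in> Fam (C1 CC) (src S f)
      (fst (p (f, endpt S (\<not> e) (src S f))), fst (p (f, i)))"
    and line_Tr: "g \<in> into S (src S f) \<Longrightarrow> H (cmp S f g, Rs (Itv S) g i) =
      Tr (C1 CC) g (fst (p (f, endpt S (\<not> e) (src S f))), fst (p (f, i))) (H (f, i))"
    and line_endpt: "i = endpt S (\<not> e) (src S f) \<Longrightarrow> H (f, i) = cid CC (src S f) (fst (p (f, i)))"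
  using line[unfolded is_hom_line_def, rule_format, OF assms] assms
  by (auto simp: ob_path_def cyl_iff endpt_At into_src_Ob)

lemma act_path_endpt: "f \<in> into S X \<Longrightarrow>
    act_path S \<Xi> \<Gamma> X \<xi> e p H (f, endpt S (\<not> e) (src S f)) = snd (p (f, endpt S (\<not> e) (src S f)))"
  by (simp add: act_path_def cyl_iff endpt_At into_src_Ob line_endpt pact_cid total_path_Fam
      Rs_into total_domD)

lemma act_partial_endpt: "f \<in> \<phi> \<Longrightarrow>
    act_partial S \<Xi> A X \<xi> e \<phi> p H a (f, endpt S (\<not> e) (src S f)) = a (f, endpt S (\<not> e) (src S f))"
  using Cof_into[OF total_domD(1,3), of f] total_partial_Fam[of f "endpt S (\<not> e) (src S f)"]
  by (simp add: act_partial_def tube_iff endpt_At into_src_Ob line_endpt tact_cid total_path_Fam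
      Rs_into total_domD)

lemma levelwise_dom:
  "(X, (\<xi>, fst (p (idm S X, endpt S (\<not> e) X))), e, \<phi>, act_path S \<Xi> \<Gamma> X \<xi> e p H,
     act_partial S \<Xi> A X \<xi> e \<phi> p H a) \<in> fib_dom S (ctx_ob CC \<Xi>) (pcar \<Gamma>) (tcar A)"
proof -
  have "fst (p (idm S X, endpt S (\<not> e) X)) \<in> At (C0 CC) X"
    using total_path_Fam(1)[of "idm S X" "endpt S (\<not> e) X"] total_domD(1)
    by (simp add: into_simps endpt_At)
  moreover have "act_path S \<Xi> \<Gamma> X \<xi> e p H
      \<in> paths S (ctx_ob CC \<Xi>) (pcar \<Gamma>) X (\<xi>, fst (p (idm S X, endpt S (\<not> e) X)))"
    unfolding act_path_def
  proof (rule restrict_paths, goal_cases)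
    case (1 f i)
    then show ?case
      by (simp add: ctx_ob_simps total_path_vertex pact_Fam line_Fam total_path_Fam endpt_At
          into_src_Ob Rs_into total_domD)
  next
    case (2 f i g)
    then show ?case
      by (simp add: ctx_ob_simps total_path_vertex total_path_endpt total_path_Tr line_Fam line_Tr
          total_path_Fam endpt_At into_simps Rs_into Rs_cmp_into pact_Tr_into total_domD)
  qed
  moreover have "act_partial S \<Xi> A X \<xi> e \<phi> p H a \<in> partials S (ctx_ob CC \<Xi>) (tcar A) X
      (\<xi>, fst (p (idm S X, endpt S (\<not> e) X))) e \<phi> (act_path S \<Xi> \<Gamma> X \<xi> e p H)"
    unfolding act_partial_def
  proof (rule restrict_partials, goal_cases)
    case (3 f i)
    then have "f \<in> into S X" "i \<in> At (Itv S) (src S f)" by (simp_all add: tube_iff)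
    with 3 show ?case
      by (simp add: ctx_ob_simps total_path_vertex tact_Fam line_Fam total_path_Fam endpt_At
          into_src_Ob Rs_into total_domD act_path_def cyl_iff total_partial_Fam)
  next
    case (4 f i g)
    then have "f \<in> into S X" "i \<in> At (Itv S) (src S f)" by (simp_all add: tube_iff)
    with 4 show ?case
      by (simp add: ctx_ob_simps total_path_vertex total_path_endpt total_path_Tr line_Fam line_Tr
          total_path_Fam endpt_At into_simps Rs_into Rs_cmp_into tact_Tr_into total_domD
          act_path_def cyl_iff total_partial_Fam total_partial_Tr)
  qed (use total_domD in auto)
  ultimately show ?thesis
    by (simp add: fib_dom_iff total_domD ctx_ob_simps)
qed

end

lemma act_path_pull:
  assumes "f \<in> into S X"
    and "\<And>g i. (g, i) \<in> cyl S (src S f) \<Longrightarrow> H' (g, i) = H (cmp S f g, i)"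
  shows "path_pull S f (act_path S \<Xi> \<Gamma> X \<xi> e p H) =
    act_path S \<Xi> \<Gamma> (src S f) (Rs \<Xi> f \<xi>) e (path_pull S f p) H'"
proof (rule ext)
  show "path_pull S f (act_path S \<Xi> \<Gamma> X \<xi> e p H) u =
    act_path S \<Xi> \<Gamma> (src S f) (Rs \<Xi> f \<xi>) e (path_pull S f p) H' u" for u
    using assms by (cases u) (auto simp: act_path_def path_pull_def cyl_iff into_simps endpt_At
        Rs_cmp_into total_domD)
qed

lemma act_partial_pull:
  assumes "f \<in> into S X"
    and "\<And>g i. (g, i) \<in> cyl S (src S f) \<Longrightarrow> H' (g, i) = H (cmp S f g, i)"
  shows "partial_pull S f e \<phi> (act_partial S \<Xi> A X \<xi> e \<phi> p H a) =
    act_partial S \<Xi> A (src S f) (Rs \<Xi> f \<xi>) e (sieve_pull S f \<phi>) (path_pull S f p) H'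
      (partial_pull S f e \<phi> a)"
proof (rule ext)
  show "partial_pull S f e \<phi> (act_partial S \<Xi> A X \<xi> e \<phi> p H a) u =
    act_partial S \<Xi> A (src S f) (Rs \<Xi> f \<xi>) e (sieve_pull S f \<phi>) (path_pull S f p) H'
      (partial_pull S f e \<phi> a) u" for u
    using assms by (cases u) (auto simp: act_partial_def path_pull_def partial_pull_def cyl_iff
        tube_iff sieve_pull_iff into_simps endpt_At Rs_cmp_into total_domD)
qed

text \<open>Every ingredient of the translation commutes with restriction, so the composition over
  the total type inherits naturality from \<open>b\<close>. The components are named through an
  equation to keep their unfolded forms out of its use.\<close>

lemma levelwise_problem_pull:
  assumes f: "f \<in> into S X"
    and lp: "levelwise_problem S CC \<Xi> c \<Gamma> A (X, \<xi>, e, \<phi>, p, a) = (X, \<zeta>, e, \<phi>, q, a')"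
  shows "levelwise_problem S CC \<Xi> c \<Gamma> A
      (src S f, Rs \<Xi> f \<xi>, e, sieve_pull S f \<phi>, path_pull S f p, partial_pull S f e \<phi> a) =
    (src S f, Rs (ctx_ob CC \<Xi>) f \<zeta>, e, sieve_pull S f \<phi>, path_pull S f q, partial_pull S f e \<phi> a')"
proof -
  let ?H = "hom_line S CC \<Xi> c X \<xi> e (ob_path S X p)"
  let ?H' = "hom_line S CC \<Xi> c (src S f) (Rs \<Xi> f \<xi>) e (ob_path S (src S f) (path_pull S f p))"
  have "ob_path S (src S f) (path_pull S f p) = path_pull S f (ob_path S X p)"
    using f by (auto simp: ob_path_def path_pull_def fun_eq_iff restrict_def cyl_iff into_simps)
  then have H: "?H' (g, i) = ?H (cmp S f g, i)" if "(g, i) \<in> cyl S (src S f)" for g i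
    using that by (simp add: cyl_iff hom_line_pull[OF presheaf_base total_domD(2) f])
  show ?thesis
    using lp f total_path_vertex[OF f, of "\<not> e"] 
      act_path_pull[OF f, of ?H' ?H, OF H] act_partial_pull[OF f, of ?H' ?H, OF H]
    by (auto simp: levelwise_problem_def Let_def ctx_ob_simps path_pull_apply into_simps endpt_At)
qed

end

lemma total_comp_fib:
  assumes c: "c \<in> fib_hom S CC \<Xi>" and b: "b \<in> fib_levelwise S CC \<Xi> \<Gamma> A"
  shows "total_comp S CC \<Xi> c \<Gamma> A b \<in> fib_total S CC \<Xi> \<Gamma> A"
proof -
  let ?K = "total_comp S CC \<Xi> c \<Gamma> A b"
  have *: "?K (X, \<xi>, e, \<phi>, p, a) \<in> Fam (total_fam S A) X (\<xi>, p (idm S X, endpt S (\<not> e) X)) \<and>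
      (\<forall>f\<in>\<phi>. Tr (total_fam S A) f (\<xi>, p (idm S X, endpt S (\<not> e) X)) (?K (X, \<xi>, e, \<phi>, p, a)) =
        a (f, endpt S (\<not> e) (src S f))) \<and>
      (\<forall>f\<in>into S X.
        Tr (total_fam S A) f (\<xi>, p (idm S X, endpt S (\<not> e) X)) (?K (X, \<xi>, e, \<phi>, p, a)) =
        ?K (src S f, Rs \<Xi> f \<xi>, e, sieve_pull S f \<phi>, path_pull S f p, partial_pull S f e \<phi> a))"
    if d: "(X, \<xi>, e, \<phi>, p, a) \<in> fib_dom S \<Xi> (total_ty CC \<Gamma>) (total_fam S A)" for X \<xi> e \<phi> p a
  proof -
    define H where "H = hom_line S CC \<Xi> c X \<xi> e (ob_path S X p)"
    define \<zeta> where "\<zeta> = (\<xi>, fst (p (idm S X, endpt S (\<not> e) X)))"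
    define q where "q = act_path S \<Xi> \<Gamma> X \<xi> e p H"
    define a' where "a' = act_partial S \<Xi> A X \<xi> e \<phi> p H a"
    have line: "is_hom_line X e (ob_path S X p) H"
      unfolding H_def
      by (rule is_hom_lineI[OF presheaf_base total_domD(2)[OF d] ob_path_paths[OF d] c])
    have lp: "levelwise_problem S CC \<Xi> c \<Gamma> A (X, \<xi>, e, \<phi>, p, a) = (X, \<zeta>, e, \<phi>, q, a')"
      by (simp add: levelwise_problem_def H_def \<zeta>_def q_def a'_def Let_def)
    have dom: "(X, \<zeta>, e, \<phi>, q, a') \<in> fib_dom S (ctx_ob CC \<Xi>) (pcar \<Gamma>) (tcar A)"
      using levelwise_dom[OF d line] by (simp add: \<zeta>_def q_def a'_def)
    \<comment> \<open>The answer of \<open>b\<close> lies over this value of \<open>q\<close>; the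
      equation retypes it over the endpoint of \<open>p\<close>.\<close>
    have q: "q (idm S X, endpt S (\<not> e) X) = snd (p (idm S X, endpt S (\<not> e) X))"
      using act_path_endpt[OF d line, of "idm S X"] total_domD(1)[OF d]
      by (simp add: q_def into_simps)
    have a': "a' (f, endpt S (\<not> e) (src S f)) = a (f, endpt S (\<not> e) (src S f))" if "f \<in> \<phi>" for f
      using act_partial_endpt[OF d line that] by (simp add: a'_def)
    have K: "?K (X, \<xi>, e, \<phi>, p, a) = b (X, \<zeta>, e, \<phi>, q, a')"
      using d by (simp add: total_comp_def lp)
    have Kf: "?K (src S f, Rs \<Xi> f \<xi>, e, sieve_pull S f \<phi>, path_pull S f p, partial_pull S f e \<phi> a) =
        b (src S f, Rs (ctx_ob CC \<Xi>) f \<zeta>, e, sieve_pull S f \<phi>, path_pull S f q,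
          partial_pull S f e \<phi> a')" if "f \<in> into S X" for f
      using fib_dom_pull[OF presheaf_base d that] levelwise_problem_pull[OF d that lp]
      by (simp add: total_comp_def)
    note b' = b[unfolded fib_levelwise_def]
    show ?thesis
      using fib_Fam[OF b' dom] fib_agrees[OF b' dom] fib_Tr[OF b' dom] a'
      unfolding K q by (simp add: Kf total_simps \<zeta>_def)
  qed
  then show ?thesis
    unfolding fib_total_def fib_def by (auto simp: total_comp_def)
qed

end

text \<open>Translating the problem and mapping it along \<open>t\<close> and \<open>s\<close>
  commute: the morphisms come from the objects alone, which \<open>s\<close> leaves fixed, and
  \<open>s\<close> commutes with the action. Fibres of \<open>A'\<close> are fibres of
  \<open>A\<close>, so both sides evaluate \<open>b\<close> at literally the same arguments.\<close>

lemma total_comp_reindex: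
  fixes \<Xi>' :: "('o, 'm, 'y) psh" and \<Xi> :: "('o, 'm, 'x) psh"
    and S :: "('o, 'm, 'i, 'z) cube_base_scheme" and CC :: "('o, 'm, 'c, 'h) icat"
    and tx :: "'u itself" and ta :: "'v itself"
  assumes "cubical_model S tx ta" "cat_type S CC \<Xi> \<Gamma> A" "cat_type S CC \<Xi>' \<Delta> A'"
    and c: "c \<in> fib_hom S CC \<Xi>" and t: "psh_map S \<Xi>' \<Xi> t"
    and s: "cat_presheaf_map S CC \<Xi>' \<Delta> t \<Gamma> s" and A': "cat_type_reindexed S CC \<Xi>' \<Delta> t s A A'"
  shows "total_comp S CC \<Xi>' (fib_hom_reindex S CC \<Xi>' t c) \<Delta> A'
      (fib_levelwise_reindex S CC \<Xi>' \<Delta> A' t s b) =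
    fib_total_reindex S CC \<Xi>' \<Delta> A' t s (total_comp S CC \<Xi> c \<Gamma> A b)"
proof -
  interpret A: cubical_cat_type S tx ta CC \<Xi> \<Gamma> A
    using assms(1,2) by (simp add: cubical_cat_type_def cubical_category_def cat_type_def
        cat_presheaf_def)
  interpret A': cubical_cat_type S tx ta CC \<Xi>' \<Delta> A'
    using assms(1,3) by (simp add: cubical_cat_type_def cubical_category_def cat_type_def
        cat_presheaf_def)
  have "total_comp S CC \<Xi>' (fib_hom_reindex S CC \<Xi>' t c) \<Delta> A'
      (fib_levelwise_reindex S CC \<Xi>' \<Delta> A' t s b) (X, \<xi>, e, \<phi>, p, a) =
    fib_total_reindex S CC \<Xi>' \<Delta> A' t s (total_comp S CC \<Xi> c \<Gamma> A b) (X, \<xi>, e, \<phi>, p, a)"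
    if d: "(X, \<xi>, e, \<phi>, p, a) \<in> fib_dom S \<Xi>' (total_ty CC \<Delta>) (total_fam S A')" for X \<xi> e \<phi> p a
  proof -
    note X = A'.total_domD[OF d]
    note p = A'.total_path_Fam[OF d]
    have t_At: "t X \<xi> \<in> At \<Xi> X"
      using t X by (simp add: psh_map_def)
    have t_Rs: "t (src S f) (Rs \<Xi>' f \<xi>) = Rs \<Xi> f (t X \<xi>)" if "f \<in> into S X" for f
      using t X that by (auto simp: psh_map_def into_def)
    have s_Fam: "s Y \<eta> x d \<in> Fam (pcar \<Gamma>) Y (t Y \<eta>, x)"
      if "Y \<in> Ob S" "\<eta> \<in> At \<Xi>' Y" "x \<in> At (C0 CC) Y" "d \<in> Fam (pcar \<Delta>) Y (\<eta>, x)" for Y \<eta> x d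
      using s that by (simp add: cat_presheaf_map_def)
    have s_Tr: "s (src S f) (Rs \<Xi>' f \<eta>) (Rs (C0 CC) f x) (Tr (pcar \<Delta>) f (\<eta>, x) d) =
        Tr (pcar \<Gamma>) f (t Y \<eta>, x) (s Y \<eta> x d)"
      if "f \<in> into S Y" "\<eta> \<in> At \<Xi>' Y" "x \<in> At (C0 CC) Y" "d \<in> Fam (pcar \<Delta>) Y (\<eta>, x)" for f Y \<eta> x d
      using s that by (auto simp: cat_presheaf_map_def into_def)
    have s_pact: "s Y \<eta> y (pact \<Delta> Y \<eta> y x h d) = pact \<Gamma> Y (t Y \<eta>) y x h (s Y \<eta> x d)"
      if "Y \<in> Ob S" "\<eta> \<in> At \<Xi>' Y" "y \<in> At (C0 CC) Y" "x \<in> At (C0 CC) Y"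
        "h \<in> Fam (C1 CC) Y (y, x)" "d \<in> Fam (pcar \<Delta>) Y (\<eta>, x)" for Y \<eta> y x h d
      using s that by (simp add: cat_presheaf_map_def)
    have A'_eq: "Fam (tcar A') Y ((\<eta>, x), d) = Fam (tcar A) Y ((t Y \<eta>, x), s Y \<eta> x d) \<and>
        (\<forall>f\<in>into S Y. \<forall>a\<in>Fam (tcar A') Y ((\<eta>, x), d).
          Tr (tcar A') f ((\<eta>, x), d) a = Tr (tcar A) f ((t Y \<eta>, x), s Y \<eta> x d) a)"
      if "Y \<in> Ob S" "\<eta> \<in> At \<Xi>' Y" "x \<in> At (C0 CC) Y" "d \<in> Fam (pcar \<Delta>) Y (\<eta>, x)" for Y \<eta> x d
      using A' that unfolding cat_type_reindexed_def ty_eq_def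
      by (auto simp: ext_def const_ty_def subst_ty_def into_def)
    have A'_tact: "tact A' Y \<eta> y x h d a = tact A Y (t Y \<eta>) y x h (s Y \<eta> x d) a"
      if "Y \<in> Ob S" "\<eta> \<in> At \<Xi>' Y" "y \<in> At (C0 CC) Y" "x \<in> At (C0 CC) Y"
        "h \<in> Fam (C1 CC) Y (y, x)" "d \<in> Fam (pcar \<Delta>) Y (\<eta>, x)" "a \<in> Fam (tcar A') Y ((\<eta>, x), d)"
      for Y \<eta> y x h d a
      using A' that by (simp add: cat_type_reindexed_def)
    \<comment> \<open>The image of \<open>p\<close> in the total type of \<open>\<Gamma>\<close>,
      written in the form that \<open>fib_reindex\<close> produces.\<close>
    define q where "q = restrict (\<lambda>(f, i). (\<lambda>(x, d). (x, s (src S f) (Rs \<Xi>' f \<xi>) x d)) (p (f, i)))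
      (cyl S X)"
    have q: "q (f, i) = (fst (p (f, i)), s (src S f) (Rs \<Xi>' f \<xi>) (fst (p (f, i))) (snd (p (f, i))))"
      if "f \<in> into S X" "i \<in> At (Itv S) (src S f)" for f i
      using that by (simp add: q_def A.cyl_iff split: prod.splits)
    have q_paths: "q \<in> paths S \<Xi> (total_ty CC \<Gamma>) X (t X \<xi>)"
    proof -
      have "restrict q (cyl S X) \<in> paths S \<Xi> (total_ty CC \<Gamma>) X (t X \<xi>)"
      proof (rule A.restrict_paths, goal_cases)
        case (1 f i)
        then show ?case
          using p[OF 1] s_Fam[of "src S f" "Rs \<Xi>' f \<xi>"] X
          by (simp add: q total_simps A.into_src_Ob A'.Rs_into t_Rs)
      next
        case (2 f i g)
        then show ?case
          using p[OF 2(1,2)] s_Tr[of g "src S f" "Rs \<Xi>' f \<xi>"] X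
          by (simp add: q total_simps A.into_simps A'.Rs_into t_Rs A'.total_path_Tr[OF d]
              A'.Rs_cmp_into A.interval.Rs_into)
      qed
      then show ?thesis by (simp add: q_def)
    qed
    have a_partials: "a \<in> partials S \<Xi> (total_fam S A) X (t X \<xi>) e \<phi> q"
    proof -
      \<comment> \<open>Reindexing leaves the partial element itself unchanged; only its typing and
        naturality over \<open>q\<close> have to be checked.\<close>
      have "restrict a (tube S X e \<phi>) \<in> partials S \<Xi> (total_fam S A) X (t X \<xi>) e \<phi> q"
      proof (rule A.restrict_partials, goal_cases)
        case (3 f i)
        then have "f \<in> into S X" "i \<in> At (Itv S) (src S f)" by (simp_all add: A.tube_iff)
        then show ?case
          using A'.total_partial_Fam[OF d 3] p A'_eq[of "src S f" "Rs \<Xi>' f \<xi>"] X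
          by (simp add: q total_simps A.into_src_Ob A'.Rs_into t_Rs)
      next
        case (4 f i g)
        then have "f \<in> into S X" "i \<in> At (Itv S) (src S f)" by (simp_all add: A.tube_iff)
        then show ?case
          using A'.total_partial_Fam[OF d 4(1)] A'.total_partial_Tr[OF d 4] 4(2) p
            A'_eq[of "src S f" "Rs \<Xi>' f \<xi>"] X
          by (simp add: q total_simps A.into_src_Ob A'.Rs_into t_Rs)
      qed (use X in auto)
      moreover have "a \<in> extensional (tube S X e \<phi>)"
        using X(5) by (auto simp: partials_def PiE_def)
      ultimately show ?thesis by (simp add: extensional_restrict)
    qed
    have d': "(X, t X \<xi>, e, \<phi>, q, a) \<in> fib_dom S \<Xi> (total_ty CC \<Gamma>) (total_fam S A)"
      using X t_At q_paths a_partials by (simp add: A.fib_dom_iff)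
    define H where "H = hom_line S CC \<Xi> c X (t X \<xi>) e (ob_path S X p)"
    define H' where "H' = hom_line S CC \<Xi>' (fib_hom_reindex S CC \<Xi>' t c) X \<xi> e (ob_path S X p)"
    have ob: "ob_path S X q = ob_path S X p"
      by (auto simp: ob_path_def q A.cyl_iff intro!: restrict_ext)
    have H': "H' (f, i) = H (f, i)" if "f \<in> into S X" "i \<in> At (Itv S) (src S f)" for f i
      using A.hom_line_reindex[OF A'.presheaf_base t X(2) A'.ob_path_paths[OF d]] that
      by (simp add: H_def H'_def A.cyl_iff)
    have "A.is_hom_line X e (ob_path S X p) H"
      unfolding H_def
      by (rule A.is_hom_lineI[OF A.presheaf_base t_At A'.ob_path_paths[OF d] c])
    \<comment> \<open>The property passes from \<open>H\<close> to \<open>H'\<close> by their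
      pointwise equality, which avoids showing that the reindexed structure lies in
      \<open>fib_hom\<close>.\<close>
    then have line: "A.is_hom_line X e (ob_path S X p) H'"
      using H' by (simp add: A.is_hom_line_def A.into_simps A.interval.Rs_into)
    note h = A'.line_Fam[OF d line]
    define x where "x = fst (p (idm S X, endpt S (\<not> e) X))"
    have qx: "fst (q (idm S X, endpt S (\<not> e) X)) = x"
      using X by (simp add: q x_def A.into_simps A.endpt_At)
    \<comment> \<open>The left side is the straightened path as \<open>fib_levelwise_reindex\<close>
      maps it. Pointwise, this is compatibility of \<open>s\<close> with the action, applied to the
      morphism \<open>H' (f, i)\<close>.\<close>
    have path: "restrict (\<lambda>(f, i). (\<lambda>(\<xi>, x). s (src S f) \<xi> x) (Rs (ctx_ob CC \<Xi>') f (\<xi>, x))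
        (act_path S \<Xi>' \<Delta> X \<xi> e p H' (f, i))) (cyl S X) = act_path S \<Xi> \<Gamma> X (t X \<xi>) e q H"
      unfolding act_path_def[of S \<Xi>]
    proof (rule restrict_ext, clarify)
      fix f i
      assume "(f, i) \<in> cyl S X"
      then have f: "f \<in> into S X" "i \<in> At (Itv S) (src S f)" by (simp_all add: A.cyl_iff)
      show "(\<lambda>(\<xi>, x). s (src S f) \<xi> x) (Rs (ctx_ob CC \<Xi>') f (\<xi>, x))
          (act_path S \<Xi>' \<Delta> X \<xi> e p H' (f, i)) =
        pact \<Gamma> (src S f) (Rs \<Xi> f (t X \<xi>)) (fst (q (f, endpt S (\<not> e) (src S f)))) (fst (q (f, i)))
          (H (f, i)) (snd (q (f, i)))"
        using f h[OF f] p X s_pact[of "src S f" "Rs \<Xi>' f \<xi>"] A'.total_path_vertex[OF d f(1), of "\<not> e"]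
        by (simp add: act_path_def A.cyl_iff ctx_ob_simps x_def q H' A.endpt_At A.into_src_Ob
            A'.Rs_into t_Rs)
    qed
    have partial: "act_partial S \<Xi>' A' X \<xi> e \<phi> p H' a = act_partial S \<Xi> A X (t X \<xi>) e \<phi> q H a"
      unfolding act_partial_def
    proof (rule restrict_ext, clarify)
      fix f i
      assume u: "(f, i) \<in> tube S X e \<phi>"
      then have f: "f \<in> into S X" "i \<in> At (Itv S) (src S f)" by (simp_all add: A.tube_iff)
      show "tact A' (src S f) (Rs \<Xi>' f \<xi>) (fst (p (f, endpt S (\<not> e) (src S f)))) (fst (p (f, i)))
          (H' (f, i)) (snd (p (f, i))) (a (f, i)) =
        tact A (src S f) (Rs \<Xi> f (t X \<xi>)) (fst (q (f, endpt S (\<not> e) (src S f)))) (fst (q (f, i)))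
          (H (f, i)) (snd (q (f, i))) (a (f, i))"
        using f h[OF f] p X A'_tact[of "src S f" "Rs \<Xi>' f \<xi>"] A'.total_partial_Fam[OF d u]
        by (simp add: q H' A.endpt_At A.into_src_Ob A'.Rs_into t_Rs)
    qed
    have "total_comp S CC \<Xi>' (fib_hom_reindex S CC \<Xi>' t c) \<Delta> A'
        (fib_levelwise_reindex S CC \<Xi>' \<Delta> A' t s b) (X, \<xi>, e, \<phi>, p, a) =
      fib_levelwise_reindex S CC \<Xi>' \<Delta> A' t s b
        (X, (\<xi>, x), e, \<phi>, act_path S \<Xi>' \<Delta> X \<xi> e p H', act_partial S \<Xi>' A' X \<xi> e \<phi> p H' a)"
      using d by (simp add: total_comp_def levelwise_problem_def H'_def x_def Let_def)
    also have "\<dots> = b (X, (t X \<xi>, x), e, \<phi>, act_path S \<Xi> \<Gamma> X (t X \<xi>) e q H,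
        act_partial S \<Xi> A X (t X \<xi>) e \<phi> q H a)"
      using A'.levelwise_dom[OF d line]
      by (simp add: fib_levelwise_reindex_def fib_reindex_def path partial flip: x_def)
    also have "\<dots> = total_comp S CC \<Xi> c \<Gamma> A b (X, t X \<xi>, e, \<phi>, q, a)"
      using d' by (simp add: total_comp_def levelwise_problem_def ob H_def qx Let_def)
    also have "\<dots> = fib_total_reindex S CC \<Xi>' \<Delta> A' t s (total_comp S CC \<Xi> c \<Gamma> A b) (X, \<xi>, e, \<phi>, p, a)"
      using d by (simp add: fib_total_reindex_def fib_reindex_def q_def)
    finally show ?thesis .
  qed
  then show ?thesis
    by (auto simp: fun_eq_iff total_comp_def fib_total_reindex_def fib_reindex_def)
qed

theorem theorem5p5:
  fixes S :: "('o, 'm, 'i, 'z) cube_base_scheme"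
    and CC :: "('o, 'm, 'c, 'h) icat"
  assumes "cubical_model S TYPE('x) TYPE('a)"
    and "internal_category S CC"
  shows "\<exists>K.
    (\<forall>(\<Xi> :: ('o, 'm, 'x) psh) c (\<Gamma> :: ('o, 'm, 'x, 'c, 'h, 'g) cpsh)
       (A :: ('o, 'm, 'x, 'c, 'h, 'g, 'a) cty).
       c \<in> fib_hom S CC \<Xi> \<longrightarrow> cat_type S CC \<Xi> \<Gamma> A \<longrightarrow>
       K \<Xi> c \<Gamma> A \<in> fib_levelwise S CC \<Xi> \<Gamma> A \<rightarrow> fib_total S CC \<Xi> \<Gamma> A) \<and>
    (\<forall>\<Xi> \<Xi>' t c \<Gamma> \<Delta> s A A' b.
       c \<in> fib_hom S CC \<Xi> \<longrightarrow> cat_type S CC \<Xi> \<Gamma> A \<longrightarrow> cat_type S CC \<Xi>' \<Delta> A' \<longrightarrow>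
       psh_map S \<Xi>' \<Xi> t \<longrightarrow> cat_presheaf_map S CC \<Xi>' \<Delta> t \<Gamma> s \<longrightarrow>
       cat_type_reindexed S CC \<Xi>' \<Delta> t s A A' \<longrightarrow>
       b \<in> fib_levelwise S CC \<Xi> \<Gamma> A \<longrightarrow>
       K \<Xi>' (fib_hom_reindex S CC \<Xi>' t c) \<Delta> A' (fib_levelwise_reindex S CC \<Xi>' \<Delta> A' t s b) =
       fib_total_reindex S CC \<Xi>' \<Delta> A' t s (K \<Xi> c \<Gamma> A b))"
\<comment> \<open>The witness stays schematic until the \<open>show\<close> below fixes it as
  \<open>total_comp S CC\<close>. It is introduced before the quantified variables, so the same
  operation serves the naturality clause.\<close>
proof (intro exI conjI allI impI)
  fix \<Xi> :: "('o, 'm, 'x) psh" and c and \<Gamma> :: "('o, 'm, 'x, 'c, 'h, 'g) cpsh"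
    and A :: "('o, 'm, 'x, 'c, 'h, 'g, 'a) cty"
  assume "c \<in> fib_hom S CC \<Xi>" and A: "cat_type S CC \<Xi> \<Gamma> A"
  interpret cubical_cat_type S "TYPE('x)" "TYPE('a)" CC \<Xi> \<Gamma> A
    using assms(1) A by (simp add: cubical_cat_type_def cubical_category_def cat_type_def
        cat_presheaf_def)
  show "total_comp S CC \<Xi> c \<Gamma> A \<in> fib_levelwise S CC \<Xi> \<Gamma> A \<rightarrow> fib_total S CC \<Xi> \<Gamma> A"
    using total_comp_fib[OF \<open>c \<in> _\<close>] by blast
qed (rule total_comp_reindex[OF assms(1)])

end
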